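(* Let $E\subset\mathbb{R}^n$ be open, let $L$ be a continuous vector field on $E$, and let $q,b:E\to\mathbb{R}$ be continuous. Let $\phi_1,\dots,\phi_{n-1}$ be functionally independent solutions of $L\phi=0$, and let $\chi_0$ be a solution of the totally linear equation $(L+q)\chi=b$. Below, $f$ denotes an arbitrary $C^1$ function in its arguments. 1. If $\chi$ is any other solution of $(L+q)\chi=b$, then $\psi=\chi-\chi_0$ is a solution of $(L+q)\psi=0$. If $\eta$ is a solution of $(L+q)\psi=0$ on $E$ with no zeros in $E$, the general solution of $(L+q)\chi=b$ is given by $$\chi=\chi_0+\eta\,f(\phi_1,\dots,\phi_{n-1}).$$ 2. If a second particular solution $\chi_1$ of $(L+q)\chi=b$ is given (with $\chi_1-\chi_0$ having no zeros in $E$), then $\eta=\chi_1-\chi_0$ is a solution of $(L+q)\psi=0$, and therefore the general solution of $(L+q)\chi=b$ can be written as $$\frac{\chi-\chi_0}{\chi_1-\chi_0}=f(\phi_1,\dots,\phi_{n-1}).$$ 3. If, with $\chi_1$ as in 2, $\chi_2$ is a third solution of $(L+q)\chi=b$, then $(\chi_2-\chi_1)/(\chi_1-\chi_0)$ is a solution of $L\phi=0$ and accordingly has the form $f(\phi_1,\dots,\phi_{n-1})$ for some $C^1$ function $f$. 4. If $n+1$ solutions $\chi_0,\chi_1,\dots,\chi_n$ of $(L+q)\chi=b$ are known (with $\chi_1-\chi_0$ having no zeros in $E$), then $\eta=\chi_1-\chi_0,\ \eta_1=\chi_2-\chi_0,\ \dots,\ \eta_{n-1}=\chi_n-\chi_0$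 are solutions of $(L+q)\psi=0$, and hence $$\frac{\eta_1}{\eta}=\frac{\chi_2-\chi_0}{\chi_1-\chi_0},\ \dots,\ \frac{\eta_{n-1}}{\eta}=\frac{\chi_n-\chi_0}{\chi_1-\chi_0}$$ are solutions of $L\phi=0$. If these ratios are functionally independent, then $$\frac{\chi-\chi_0}{\chi_1-\chi_0}=f\left(\frac{\chi_2-\chi_0}{\chi_1-\chi_0},\dots,\frac{\chi_n-\chi_0}{\chi_1-\chi_0}\right)$$ gives the general solution $\chi$ of $(L+q)\chi=b$ in terms of $n+1$ particular solutions; and if $\chi_{n+1}$ is a further solution of $(L+q)\chi=b$, then $(\chi_{n+1}-\chi_0)/(\chi_1-\chi_0)$ is some function of these ratios. The $n+1$ solutions $\chi_0,\dots,\chi_n$ themselves are certainly functionally dependent.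
   Context: In a global system of coordinates $(x_1,\dots,x_n)$ on $E$, $L=\sum_{k=1}^n a_k(x_1,\dots,x_n)\,\partial/\partial x_k$ with $a_k\in C^0(E)$. It acts on $C^1(E)$ by $L\psi=\sum_k a_k\,\partial\psi/\partial x_k$, and $(L+q)\psi=L\psi+q\psi$. Solutions are $C^1$ functions on $E$. "Functionally independent" has its usual meaning (linearly independent differentials), and "functionally dependent" means having linearly dependent differentials. "General solution" means that the functions $\chi$ of the indicated form, as $f$ varies, are the solutions of the equation.
   Formalization: That every solution has the stated form is proved assuming L vanishes identically on no nonempty open subset of E, with f found near each point of E, and one f on all of E when the joint level sets of the arguments of f are connected; as stated it fails for L=0 and for some non-convex E. *)

theory Defs
  imports "HOL-Analysis.Analysis"
begin

definition C1_on :: "(real ^ 'n) set \<Rightarrow> (real ^ 'n \<Rightarrow> real) \<Rightarrow> bool" where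
  "C1_on E f \<longleftrightarrow> (\<exists>D. continuous_on E D \<and> (\<forall>x\<in>E. GDERIV f x :> D x))"

definition partial :: "'n \<Rightarrow> (real ^ 'n \<Rightarrow> real) \<Rightarrow> real ^ 'n \<Rightarrow> real" where
  "partial k f x = frechet_derivative f (at x) (axis k 1)"

text \<open>The vector field with components \<open>a\<close>, acting on functions, and the operator \<open>L + q\<close>.\<close>

definition vf :: "(real ^ 'n \<Rightarrow> real ^ 'n) \<Rightarrow> (real ^ 'n \<Rightarrow> real) \<Rightarrow> real ^ 'n \<Rightarrow> real" where
  "vf a \<psi> x = (\<Sum>k\<in>UNIV. a x $ k * partial k \<psi> x)"

definition vf_plus ::
  "(real ^ 'n \<Rightarrow> real ^ 'n) \<Rightarrow> (real ^ 'n \<Rightarrow> real) \<Rightarrow> (real ^ 'n \<Rightarrow> real) \<Rightarrow> real ^ 'n \<Rightarrow> real" where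
  "vf_plus a q \<psi> x = vf a \<psi> x + q x * \<psi> x"

definition solution ::
  "(real ^ 'n) set \<Rightarrow> ((real ^ 'n \<Rightarrow> real) \<Rightarrow> real ^ 'n \<Rightarrow> real) \<Rightarrow> (real ^ 'n \<Rightarrow> real)
    \<Rightarrow> (real ^ 'n \<Rightarrow> real) \<Rightarrow> bool" where
  "solution E T b chi \<longleftrightarrow> C1_on E chi \<and> (\<forall>x\<in>E. T chi x = b x)"

text \<open>Linear (in)dependence of the differentials of the family \<open>(g i)\<close>, \<open>i \<in> I\<close>, at every
  point. It is a condition on the family, not on the set of its members.\<close>

definition functionally_independent ::
  "nat set \<Rightarrow> (nat \<Rightarrow> real ^ 'n \<Rightarrow> real) \<Rightarrow> (real ^ 'n) set \<Rightarrow> bool" where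
  "functionally_independent I g E \<longleftrightarrow>
     (\<forall>x\<in>E. \<forall>c :: nat \<Rightarrow> real.
        (\<forall>h. (\<Sum>i\<in>I. c i * frechet_derivative (g i) (at x) h) = 0) \<longrightarrow> (\<forall>i\<in>I. c i = 0))"

definition functionally_dependent ::
  "nat set \<Rightarrow> (nat \<Rightarrow> real ^ 'n \<Rightarrow> real) \<Rightarrow> (real ^ 'n) set \<Rightarrow> bool" where
  "functionally_dependent I g E \<longleftrightarrow>
     (\<forall>x\<in>E. \<exists>c :: nat \<Rightarrow> real. (\<exists>i\<in>I. c i \<noteq> 0) \<and>
        (\<forall>h. (\<Sum>i\<in>I. c i * frechet_derivative (g i) (at x) h) = 0))"

text \<open>Functions of the real arguments \<open>(y i)\<close>, \<open>i \<in> I\<close>. The argument space is the product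
  \<open>I \<rightarrow>\<^sub>E UNIV\<close> with its product topology. For \<open>I = {1..n-1}\<close> this is Euclidean space of
  dimension \<open>n - 1\<close>, including the one-point space when \<open>n = 1\<close> (no type \<open>real ^ 'm\<close> has
  dimension 0). \<open>C1_args I W f\<close>: \<open>f\<close> is \<open>C\<^sup>1\<close> on the open set \<open>W\<close>, i.e. its first
  partial derivatives exist and are continuous on \<open>W\<close>.\<close>

abbreviation arg_space :: "nat set \<Rightarrow> (nat \<Rightarrow> real) topology" where
  "arg_space I \<equiv> product_topology (\<lambda>_. euclideanreal) I"

definition C1_args :: "nat set \<Rightarrow> (nat \<Rightarrow> real) set \<Rightarrow> ((nat \<Rightarrow> real) \<Rightarrow> real) \<Rightarrow> bool" where
  "C1_args I W f \<longleftrightarrow> openin (arg_space I) W \<and>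
     (\<exists>g. \<forall>i\<in>I.
        (\<forall>y\<in>W. ((\<lambda>t. f (y(i := t))) has_real_derivative g i y) (at (y i))) \<and>
        continuous_map (subtopology (arg_space I) W) euclideanreal (g i))"

text \<open>\<open>of_form I \<phi> U P\<close>: there is a single \<open>C\<^sup>1\<close> function \<open>f\<close>, defined on an open set
  containing the values \<open>(\<phi> i x)\<close> for \<open>x \<in> U\<close>, with \<open>P x v\<close> for all \<open>x \<in> U\<close>, where
  \<open>v = f(\<phi> i x : i \<in> I)\<close>. For instance \<open>P x v \<longleftrightarrow> u x = v\<close> says \<open>u = f(\<phi>)\<close> on \<open>U\<close>.\<close>

definition of_form ::
  "nat set \<Rightarrow> (nat \<Rightarrow> real ^ 'n \<Rightarrow> real) \<Rightarrow> (real ^ 'n) set \<Rightarrow> (real ^ 'n \<Rightarrow> real \<Rightarrow> bool) \<Rightarrow> bool" where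
  "of_form I \<phi> U P \<longleftrightarrow>
     (\<exists>W f. C1_args I W f \<and>
        (\<forall>x\<in>U. (\<lambda>i\<in>I. \<phi> i x) \<in> W \<and> P x (f (\<lambda>i\<in>I. \<phi> i x))))"

definition locally_of_form ::
  "nat set \<Rightarrow> (nat \<Rightarrow> real ^ 'n \<Rightarrow> real) \<Rightarrow> (real ^ 'n) set \<Rightarrow> (real ^ 'n \<Rightarrow> real \<Rightarrow> bool) \<Rightarrow> bool" where
  "locally_of_form I \<phi> E P \<longleftrightarrow>
     (\<forall>p\<in>E. \<exists>U. open U \<and> p \<in> U \<and> U \<subseteq> E \<and> of_form I \<phi> U P)"

definition connected_levels ::
  "nat set \<Rightarrow> (nat \<Rightarrow> real ^ 'n \<Rightarrow> real) \<Rightarrow> (real ^ 'n) set \<Rightarrow> bool" where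
  "connected_levels I \<phi> E \<longleftrightarrow> (\<forall>c. connected {x\<in>E. \<forall>i\<in>I. \<phi> i x = c i})"

text \<open>A function that is constant along \<open>L\<close> can take different values on different components
  of one joint level set of the \<open>\<phi> i\<close>. So it is a function of the \<open>\<phi> i\<close> near every point,
  and with one \<open>f\<close> on all of \<open>E\<close> when the level sets are connected. (Example: \<open>E\<close> the plane
  without the closed half-line \<open>x = 0, y \<ge> 0\<close>, \<open>L = \<partial>/\<partial>x\<close>, \<open>\<phi> = y\<close>, and the function that is
  \<open>y\<^sup>2\<close> for \<open>x, y > 0\<close> and 0 elsewhere.)\<close>

definition has_form ::
  "nat set \<Rightarrow> (nat \<Rightarrow> real ^ 'n \<Rightarrow> real) \<Rightarrow> (real ^ 'n) set \<Rightarrow> (real ^ 'n \<Rightarrow> real \<Rightarrow> bool) \<Rightarrow> bool" where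
  "has_form I \<phi> E P \<longleftrightarrow>
     locally_of_form I \<phi> E P \<and> (connected_levels I \<phi> E \<longrightarrow> of_form I \<phi> E P)"

text \<open>In the two definitions below, \<open>P chi x v\<close> is the formula relating the candidate \<open>chi\<close> at \<open>x\<close> to
  \<open>v = f(\<phi> x)\<close>. On an open \<open>E\<close>, \<open>of_form\<close> implies \<open>locally_of_form\<close>, so the first definition
  also covers one \<open>f\<close> on all of \<open>E\<close>.\<close>

definition form_gives_solutions ::
  "nat set \<Rightarrow> (nat \<Rightarrow> real ^ 'n \<Rightarrow> real) \<Rightarrow> (real ^ 'n) set \<Rightarrow> ((real ^ 'n \<Rightarrow> real) \<Rightarrow> bool)
    \<Rightarrow> ((real ^ 'n \<Rightarrow> real) \<Rightarrow> real ^ 'n \<Rightarrow> real \<Rightarrow> bool) \<Rightarrow> bool" where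
  "form_gives_solutions I \<phi> E S P \<longleftrightarrow> (\<forall>chi. locally_of_form I \<phi> E (P chi) \<longrightarrow> S chi)"

definition general_solution ::
  "nat set \<Rightarrow> (nat \<Rightarrow> real ^ 'n \<Rightarrow> real) \<Rightarrow> (real ^ 'n) set \<Rightarrow> ((real ^ 'n \<Rightarrow> real) \<Rightarrow> bool)
    \<Rightarrow> ((real ^ 'n \<Rightarrow> real) \<Rightarrow> real ^ 'n \<Rightarrow> real \<Rightarrow> bool) \<Rightarrow> bool" where
  "general_solution I \<phi> E S P \<longleftrightarrow>
     form_gives_solutions I \<phi> E S P \<and> (\<forall>chi. S chi \<longrightarrow> has_form I \<phi> E (P chi))"

text \<open>The field vanishes identically on no nonempty open subset of \<open>E\<close>. Where it did, every
  function would be constant along it, and \<open>n - 1\<close> functions could not determine it.\<close>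

definition nondegenerate :: "(real ^ 'n \<Rightarrow> real ^ 'n) \<Rightarrow> (real ^ 'n) set \<Rightarrow> bool" where
  "nondegenerate a E \<longleftrightarrow> interior {x\<in>E. a x = 0} = {}"

end

theory Submission
  imports Defs
begin

text \<open>Dividing by a nowhere vanishing solution \<open>\<eta>\<close> of \<open>(L + q)\<psi> = 0\<close> reduces everything to the equation
  \<open>L u = 0\<close>: the difference of two solutions of \<open>(L + q)\<chi> = b\<close> solves the homogeneous equation
  (\<open>solution_diff\<close>), the ratio of two homogeneous solutions is a first integral (\<open>solution_divide\<close>), and
  conversely \<open>\<chi>\<^sub>0 + \<eta> u\<close> is a solution for every first integral \<open>u\<close> (\<open>solution_add_mult\<close>). Hence the general
  solution is \<open>\<chi>\<^sub>0 + \<eta> u\<close>, and it remains to see that the first integrals are the functions of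
  \<open>\<phi>\<^sub>1, \<dots>, \<phi>\<^sub>n\<^sub>-\<^sub>1\<close>.

  One direction is the chain rule, in the form needed for functions of which only continuous partial
  derivatives are known (\<open>compose_args_chain_rule\<close>).

  For the other, complete the \<open>\<phi> i\<close> to a local chart by one linear function (\<open>exists_transversal_row\<close>,
  \<open>local_chart\<close>). Where the field does not vanish it is tangent to the curves on which all the \<open>\<phi> i\<close> are
  constant, so \<open>u\<close> has derivative 0 along them; as the field is nonzero on a dense set and \<open>u\<close> is \<open>C\<^sup>1\<close>, this
  persists everywhere (\<open>transversal_derivative_zero\<close>). So \<open>u\<close> depends only on the \<open>\<phi> i\<close> near each point
  (\<open>local_function_of_first_integrals\<close>). When joint level sets are connected, \<open>u\<close> is constant on each of them,
  and the local functions are glued over the open image of the \<open>\<phi> i\<close>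
  (\<open>extend_function_of_first_integrals\<close>).

  The particular solutions of the last part give first integrals \<open>\<rho> i\<close> that can be used in place of the \<open>\<phi> i\<close>; that
  \<open>n + 1\<close> functions of \<open>n\<close> variables are dependent is linear algebra.\<close>

section \<open>Gradients and the algebra of solutions\<close>

text \<open>The junk values of \<open>partial\<close> at points of non-differentiability are harmless: all facts about
  \<open>gradv\<close> pass through \<open>GDERIV\<close>, which pins the gradient down.\<close>
definition gradv :: "(real ^ 'n \<Rightarrow> real) \<Rightarrow> real ^ 'n \<Rightarrow> real ^ 'n" where
  "gradv f x = (\<chi> k. partial k f x)"

lemma gradv_eq: "GDERIV f x :> D \<Longrightarrow> gradv f x = D"
  unfolding gderiv_def gradv_def partial_def
  by (auto simp: vec_eq_iff inner_axis' simp flip: frechet_derivative_at)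

lemma frechet_derivative_eq: "GDERIV f x :> D \<Longrightarrow> frechet_derivative f (at x) h = h \<bullet> D"
  unfolding gderiv_def by (metis frechet_derivative_at)

lemma vf_eq: "vf a f x = a x \<bullet> gradv f x"
  by (simp add: vf_def gradv_def inner_vec_def)

lemma C1_on_iff:
  "C1_on E f \<longleftrightarrow> (\<forall>x\<in>E. GDERIV f x :> gradv f x) \<and> continuous_on E (gradv f)"
proof
  assume "C1_on E f"
  then obtain D where D: "continuous_on E D" "\<And>x. x \<in> E \<Longrightarrow> GDERIV f x :> D x"
    unfolding C1_on_def by blast
  moreover have "gradv f x = D x" if "x \<in> E" for x
    using D(2)[OF that] by (rule gradv_eq)
  ultimately show "(\<forall>x\<in>E. GDERIV f x :> gradv f x) \<and> continuous_on E (gradv f)"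
    by (simp cong: continuous_on_cong)
qed (auto simp: C1_on_def)

lemma C1_onI: "continuous_on E D \<Longrightarrow> (\<And>x. x \<in> E \<Longrightarrow> GDERIV f x :> D x) \<Longrightarrow> C1_on E f"
  unfolding C1_on_def by blast

lemma C1_on_GDERIV: "C1_on E f \<Longrightarrow> x \<in> E \<Longrightarrow> GDERIV f x :> gradv f x"
  and C1_on_continuous_gradv: "C1_on E f \<Longrightarrow> continuous_on E (gradv f)"
  by (auto simp: C1_on_iff)

lemma C1_on_continuous: "C1_on E f \<Longrightarrow> continuous_on E f"
  by (meson C1_on_GDERIV continuous_at_imp_continuous_on gderiv_def has_derivative_continuous)

lemma GDERIV_cong_open:
  assumes "GDERIV f x :> D" "open U" "x \<in> U" "\<And>y. y \<in> U \<Longrightarrow> g y = f y"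
  shows "GDERIV g x :> D"
  using assms unfolding gderiv_def by (metis has_derivative_transform_within_open)

lemma solution_cong:
  assumes "solution U (vf_plus a q) b f" "open U" "\<And>x. x \<in> U \<Longrightarrow> g x = f x"
  shows "solution U (vf_plus a q) b g"
proof -
  have G: "GDERIV g x :> gradv f x" if "x \<in> U" for x
    using assms that C1_on_GDERIV unfolding solution_def by (blast intro: GDERIV_cong_open)
  then have "gradv g x = gradv f x" if "x \<in> U" for x
    using that gradv_eq by blast
  with G assms show ?thesis
    unfolding solution_def vf_plus_def vf_eq
    by (auto intro!: C1_onI[where D = "gradv f"] C1_on_continuous_gradv)
qed

text \<open>Both halves of being a solution, continuous differentiability and the equation, are conditions at
  single points. This is what lets a merely local representation \<open>f(\<phi>)\<close> certify a solution.\<close>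
lemma solution_local:
  assumes "\<And>p. p \<in> E \<Longrightarrow> \<exists>U. open U \<and> p \<in> U \<and> solution U (vf_plus a q) b f"
  shows "solution E (vf_plus a q) b f"
proof -
  have "GDERIV f x :> gradv f x" "isCont (gradv f) x" "vf_plus a q f x = b x" if "x \<in> E" for x
    using assms[OF that] unfolding solution_def C1_on_iff
    by (auto simp: continuous_on_eq_continuous_at)
  then show ?thesis
    unfolding solution_def C1_on_iff by (auto intro: continuous_at_imp_continuous_on)
qed

lemma solution_subset: "solution E T b f \<Longrightarrow> U \<subseteq> E \<Longrightarrow> solution U T b f"
  unfolding solution_def C1_on_def by (meson continuous_on_subset subsetD)

lemma solution_diff:
  assumes "solution E (vf_plus a q) b f" "solution E (vf_plus a q) b g"
  shows "solution E (vf_plus a q) (\<lambda>_. 0) (\<lambda>x. f x - g x)"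
proof -
  have G: "GDERIV (\<lambda>x. f x - g x) x :> gradv f x - gradv g x" if "x \<in> E" for x
    using assms that unfolding solution_def by (blast intro: GDERIV_diff C1_on_GDERIV)
  then have g: "gradv (\<lambda>x. f x - g x) x = gradv f x - gradv g x" if "x \<in> E" for x
    using that gradv_eq by blast
  with assms show ?thesis
    unfolding solution_def vf_plus_def vf_eq
    by (auto intro!: C1_onI[OF _ G] continuous_intros C1_on_continuous_gradv
        simp: g algebra_simps)
qed

text \<open>\<open>(L + q)(h u) = h L u + u (L + q) h\<close>, so multiplying a homogeneous solution by a first integral
  gives a homogeneous solution.\<close>
lemma solution_add_mult:
  assumes "solution E (vf_plus a q) b f" "solution E (vf_plus a q) (\<lambda>_. 0) h"
    and "solution E (vf a) (\<lambda>_. 0) u"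
  shows "solution E (vf_plus a q) b (\<lambda>x. f x + h x * u x)"
proof -
  have G: "GDERIV (\<lambda>x. f x + h x * u x) x :> gradv f x + (h x *\<^sub>R gradv u x + u x *\<^sub>R gradv h x)"
    if "x \<in> E" for x
    using assms that unfolding solution_def
    by (auto intro!: GDERIV_add GDERIV_mult C1_on_GDERIV)
  then have g: "gradv (\<lambda>x. f x + h x * u x) x = gradv f x + (h x *\<^sub>R gradv u x + u x *\<^sub>R gradv h x)"
    if "x \<in> E" for x
    using that gradv_eq by blast
  have "vf_plus a q (\<lambda>x. f x + h x * u x) x = b x" if "x \<in> E" for x
  proof -
    have "vf_plus a q (\<lambda>x. f x + h x * u x) x
        = vf_plus a q f x + (h x * vf a u x + u x * vf_plus a q h x)"
      by (simp add: vf_plus_def vf_eq g[OF that] algebra_simps inner_add_right)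
    then show ?thesis
      using assms that by (simp add: solution_def)
  qed
  with assms show ?thesis
    unfolding solution_def
    by (auto intro!: C1_onI[OF _ G] continuous_intros C1_on_continuous_gradv C1_on_continuous)
qed

text \<open>In the quotient rule the two terms \<open>- q f h\<close> cancel, so the ratio no longer sees \<open>q\<close>.\<close>
lemma solution_divide:
  assumes "solution E (vf_plus a q) (\<lambda>_. 0) f" "solution E (vf_plus a q) (\<lambda>_. 0) h"
    and nz: "\<And>x. x \<in> E \<Longrightarrow> h x \<noteq> 0"
  shows "solution E (vf a) (\<lambda>_. 0) (\<lambda>x. f x / h x)"
proof -
  let ?D = "\<lambda>x. f x *\<^sub>R (- (inverse (h x))\<^sup>2 *\<^sub>R gradv h x) + inverse (h x) *\<^sub>R gradv f x"
  have G: "GDERIV (\<lambda>x. f x / h x) x :> ?D x" if "x \<in> E" for x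
    unfolding divide_inverse using assms that unfolding solution_def
    by (intro GDERIV_mult GDERIV_inverse C1_on_GDERIV) auto
  then have g: "gradv (\<lambda>x. f x / h x) x = ?D x" if "x \<in> E" for x
    using that gradv_eq by blast
  have "vf a (\<lambda>x. f x / h x) x = 0" if "x \<in> E" for x
  proof -
    have "a x \<bullet> gradv f x = - q x * f x" "a x \<bullet> gradv h x = - q x * h x"
      using assms that by (auto simp: solution_def vf_plus_def vf_eq)
    then show ?thesis
      using nz[OF that] by (simp add: vf_eq g[OF that] inner_add_right inner_diff_right power2_eq_square field_simps)
  qed
  with assms show ?thesis
    unfolding solution_def
    by (auto intro!: C1_onI[OF _ G] continuous_intros intro: C1_on_continuous_gradv C1_on_continuous)
qed

section \<open>Continuously differentiable functions of finitely many real arguments\<close>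

text \<open>For finite \<open>I\<close> these boxes are a neighbourhood basis of \<open>y\<close> in \<open>arg_space I\<close>. They reduce
  \<open>C1_args\<close> to an \<open>\<epsilon>\<close>-\<open>\<delta>\<close> condition, so that the case of an empty \<open>I\<close> is treated like any other.\<close>
definition arg_box :: "nat set \<Rightarrow> (nat \<Rightarrow> real) \<Rightarrow> real \<Rightarrow> (nat \<Rightarrow> real) set" where
  "arg_box I y e = {z \<in> extensional I. \<forall>i\<in>I. \<bar>z i - y i\<bar> < e}"

lemma finite_uniform_radius:
  assumes "finite I" "\<And>i. i \<in> I \<Longrightarrow> \<exists>e>0::real. P i e" "\<And>i e d. P i e \<Longrightarrow> d \<le> e \<Longrightarrow> P i d"
  shows "\<exists>e>0. \<forall>i\<in>I. P i e"
proof -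
  obtain r where r: "\<And>i. i \<in> I \<Longrightarrow> r i > 0 \<and> P i (r i)"
    using assms(2) by metis
  let ?e = "Min (insert 1 (r ` I))"
  have "?e > 0" using assms(1) r by (subst Min_gr_iff) auto
  moreover have "P i ?e" if "i \<in> I" for i
    by (rule assms(3)[of i "r i"]) (use r that assms(1) in auto)
  ultimately show ?thesis by blast
qed

lemma openin_arg_space_iff:
  assumes "finite I"
  shows "openin (arg_space I) W \<longleftrightarrow> W \<subseteq> extensional I \<and> (\<forall>y\<in>W. \<exists>e>0. arg_box I y e \<subseteq> W)"
proof
  assume W: "openin (arg_space I) W"
  then have "W \<subseteq> extensional I"
    using openin_subset[OF W] by (auto simp: PiE_def)
  moreover have "\<exists>e>0. arg_box I y e \<subseteq> W" if y: "y \<in> W" for y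
  proof -
    obtain U where "\<forall>i\<in>I. openin euclideanreal (U i)" and U: "y \<in> Pi\<^sub>E I U" "Pi\<^sub>E I U \<subseteq> W"
      using W[unfolded openin_product_topology_alt, rule_format, OF y] by metis
    then have opn: "\<And>i. i \<in> I \<Longrightarrow> open (U i)" by (simp flip: open_openin)
    have "\<exists>e>0. \<forall>i\<in>I. \<forall>t. \<bar>t - y i\<bar> < e \<longrightarrow> t \<in> U i"
    proof (rule finite_uniform_radius[OF assms])
      fix i assume "i \<in> I"
      then show "\<exists>e>0. \<forall>t. \<bar>t - y i\<bar> < e \<longrightarrow> t \<in> U i"
        using opn[of i] U(1) unfolding open_dist by (auto simp: dist_real_def PiE_iff)
    qed auto
    then obtain e where e: "e > 0" "\<And>i t. i \<in> I \<Longrightarrow> \<bar>t - y i\<bar> < e \<Longrightarrow> t \<in> U i"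
      by blast
    then have "arg_box I y e \<subseteq> Pi\<^sub>E I U"
      by (auto simp: arg_box_def PiE_def)
    with e U show ?thesis by blast
  qed
  ultimately show "W \<subseteq> extensional I \<and> (\<forall>y\<in>W. \<exists>e>0. arg_box I y e \<subseteq> W)"
    by blast
next
  assume W: "W \<subseteq> extensional I \<and> (\<forall>y\<in>W. \<exists>e>0. arg_box I y e \<subseteq> W)"
  show "openin (arg_space I) W"
    unfolding openin_product_topology_alt
  proof
    fix y assume y: "y \<in> W"
    then obtain e where e: "e > 0" "arg_box I y e \<subseteq> W" using W by blast
    let ?U = "\<lambda>i. {y i - e<..<y i + e}"
    have "Pi\<^sub>E I ?U \<subseteq> arg_box I y e"
      by (auto simp: arg_box_def PiE_iff abs_less_iff algebra_simps)
    moreover have "y \<in> Pi\<^sub>E I ?U" using W y e by (auto simp: PiE_iff)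
    ultimately show "\<exists>U. finite {i \<in> I. U i \<noteq> topspace euclideanreal} \<and>
        (\<forall>i\<in>I. openin euclideanreal (U i)) \<and> y \<in> Pi\<^sub>E I U \<and> Pi\<^sub>E I U \<subseteq> W"
      using assms e by (intro exI[of _ ?U]) (auto simp flip: open_openin)
  qed
qed

lemma openin_arg_box:
  assumes "finite I" shows "openin (arg_space I) (arg_box I y e)"
  unfolding openin_arg_space_iff[OF assms]
proof (intro conjI ballI)
  fix z assume z: "z \<in> arg_box I y e"
  have "\<exists>d>0. \<forall>i\<in>I. \<bar>z i - y i\<bar> + d \<le> e"
  proof (rule finite_uniform_radius[OF assms])
    fix i assume "i \<in> I"
    with z show "\<exists>d>0. \<bar>z i - y i\<bar> + d \<le> e"
      by (intro exI[of _ "e - \<bar>z i - y i\<bar>"]) (auto simp: arg_box_def)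
  qed auto
  then obtain d where d: "d > 0" "\<And>i. i \<in> I \<Longrightarrow> \<bar>z i - y i\<bar> + d \<le> e" by blast
  have "arg_box I z d \<subseteq> arg_box I y e"
    unfolding arg_box_def using d(2) by fastforce
  with d show "\<exists>d>0. arg_box I z d \<subseteq> arg_box I y e" by blast
qed (auto simp: arg_box_def)

lemma continuous_map_arg_space_iff:
  assumes I: "finite I" and W: "openin (arg_space I) W"
  shows "continuous_map (subtopology (arg_space I) W) euclideanreal g \<longleftrightarrow>
    (\<forall>y\<in>W. \<forall>\<epsilon>>0. \<exists>d>0. \<forall>z\<in>arg_box I y d. z \<in> W \<and> \<bar>g z - g y\<bar> < \<epsilon>)"
    (is "?L \<longleftrightarrow> ?R")
proof
  have top: "topspace (subtopology (arg_space I) W) = W"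
    using openin_subset[OF W] by (auto simp: topspace_subtopology)
  {
    assume L: ?L
    show ?R
    proof (intro ballI allI impI)
      fix y and \<epsilon> :: real assume y: "y \<in> W" "\<epsilon> > 0"
      have "openin (subtopology (arg_space I) W) {z \<in> W. g z \<in> ball (g y) \<epsilon>}"
        using openin_continuous_map_preimage[OF L, of "ball (g y) \<epsilon>"]
        unfolding top by (simp flip: open_openin)
      then have "openin (arg_space I) {z \<in> W. g z \<in> ball (g y) \<epsilon>}"
        using W openin_open_subtopology by blast
      moreover have "y \<in> {z \<in> W. g z \<in> ball (g y) \<epsilon>}" using y by simp
      ultimately obtain d where "d > 0" "arg_box I y d \<subseteq> {z \<in> W. g z \<in> ball (g y) \<epsilon>}"
        unfolding openin_arg_space_iff[OF I] by blast
      then show "\<exists>d>0. \<forall>z\<in>arg_box I y d. z \<in> W \<and> \<bar>g z - g y\<bar> < \<epsilon>"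
        by (intro exI[of _ d]) (auto simp: dist_real_def)
    qed
  next
    assume R: ?R
    have "openin (subtopology (arg_space I) W) {z \<in> W. g z \<in> S}" if S: "open S" for S
      unfolding openin_open_subtopology[OF W] openin_arg_space_iff[OF I]
    proof (intro conjI ballI)
      show "{z \<in> W. g z \<in> S} \<subseteq> extensional I"
        using W unfolding openin_arg_space_iff[OF I] by blast
      fix y assume y: "y \<in> {z \<in> W. g z \<in> S}"
      then obtain \<epsilon> where "\<epsilon> > 0" and \<epsilon>: "\<And>t. \<bar>t - g y\<bar> < \<epsilon> \<Longrightarrow> t \<in> S"
        using S unfolding open_dist dist_real_def by blast
      then obtain d where "d > 0" "\<forall>z\<in>arg_box I y d. z \<in> W \<and> \<bar>g z - g y\<bar> < \<epsilon>"
        using R y by blast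
      then show "\<exists>e>0. arg_box I y e \<subseteq> {z \<in> W. g z \<in> S}"
        using \<epsilon> by blast
    qed auto
    then show ?L
      unfolding continuous_map_def top by (simp flip: open_openin)
  }
qed

lemma C1_args_iff:
  assumes "finite I"
  shows "C1_args I W f \<longleftrightarrow> openin (arg_space I) W \<and>
    (\<exists>g. \<forall>i\<in>I. \<forall>y\<in>W.
      ((\<lambda>t. f (y(i := t))) has_real_derivative g i y) (at (y i)) \<and>
      (\<forall>\<epsilon>>0. \<exists>d>0. \<forall>z\<in>arg_box I y d. z \<in> W \<and> \<bar>g i z - g i y\<bar> < \<epsilon>))"
  unfolding C1_args_def
  by (intro conj_cong refl ex_cong1 ball_cong)
     (simp add: continuous_map_arg_space_iff[OF assms] ball_conj_distrib)

text \<open>At a zero of \<open>F\<close>, continuity of \<open>R\<close> is enough for the product rule. In the chain rule below \<open>R\<close> is a difference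
  quotient, of which nothing more is known.\<close>
lemma has_derivative_mult_vanishing:
  fixes F R :: "'a::real_normed_vector \<Rightarrow> real"
  assumes F: "(F has_derivative F') (at x)" "F x = 0" and R: "isCont R x"
  shows "((\<lambda>z. F z * R z) has_derivative (\<lambda>h. F' h * R x)) (at x)"
  unfolding has_derivative_at_alt
proof (intro conjI allI impI)
  interpret F': bounded_linear F' using F(1) by (rule has_derivative_bounded_linear)
  show "bounded_linear (\<lambda>h. F' h * R x)"
    using F'.bounded_linear_axioms by (rule bounded_linear_mult_const)
  fix e :: real assume e: "e > 0"
  define K where "K = onorm F' + 1"
  have K: "K \<ge> 1" using onorm_pos_le[OF F'.bounded_linear_axioms] by (simp add: K_def)
  define c where "c = \<bar>R x\<bar> + 1"
  have c: "c > 0" by (simp add: c_def)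
  let ?d = "min 1 (e / (2 * c))"
  have "?d > 0" using e c by simp
  then obtain d1 where d1: "d1 > 0"
    "\<And>z. norm (z - x) < d1 \<Longrightarrow> \<bar>F z - F' (z - x)\<bar> \<le> ?d * norm (z - x)"
    using F unfolding has_derivative_at_alt by (metis diff_zero real_norm_def)
  have "e / (2 * K) > 0" using e K by simp
  then obtain d2 where d2: "d2 > 0" "\<And>z. norm (z - x) < d2 \<Longrightarrow> \<bar>R z - R x\<bar> < e / (2 * K)"
    using R unfolding continuous_at_eps_delta dist_norm real_norm_def by blast
  have "norm (F z * R z - F x * R x - F' (z - x) * R x) \<le> e * norm (z - x)"
    if z: "norm (z - x) < min d1 d2" for z
  proof -
    let ?n = "norm (z - x)"
    have 1: "\<bar>F z - F' (z - x)\<bar> \<le> ?d * ?n" using d1(2)[of z] z by simp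
    have "\<bar>F' (z - x)\<bar> \<le> onorm F' * ?n"
      using onorm[OF F'.bounded_linear_axioms] by (metis real_norm_def)
    moreover have "?d * ?n \<le> 1 * ?n" by (intro mult_right_mono) auto
    ultimately have 2: "\<bar>F z\<bar> \<le> K * ?n" using 1 by (simp add: K_def algebra_simps)
    have "\<bar>F z * (R z - R x)\<bar> \<le> (K * ?n) * (e / (2 * K))"
      unfolding abs_mult by (intro mult_mono 2 less_imp_le[OF d2(2)]) (use z K in auto)
    also have "\<dots> = e / 2 * ?n" using K by simp
    finally have 3: "\<bar>F z * (R z - R x)\<bar> \<le> e / 2 * ?n" .
    have "?d * ?n \<le> e / (2 * c) * ?n" by (intro mult_right_mono) auto
    with 1 have "\<bar>F z - F' (z - x)\<bar> \<le> e / (2 * c) * ?n" by linarith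
    then have "\<bar>(F z - F' (z - x)) * R x\<bar> \<le> (e / (2 * c) * ?n) * c"
      unfolding abs_mult by (intro mult_mono) (use e c in \<open>auto simp: c_def\<close>)
    also have "\<dots> = e / 2 * ?n" using c by simp
    finally have 4: "\<bar>(F z - F' (z - x)) * R x\<bar> \<le> e / 2 * ?n" .
    have "F z * R z - F x * R x - F' (z - x) * R x
        = F z * (R z - R x) + (F z - F' (z - x)) * R x"
      unfolding F(2) by (simp add: algebra_simps)
    then show ?thesis using 3 4 by (simp only: real_norm_def)
  qed
  then show "\<exists>d>0. \<forall>z. norm (z - x) < d \<longrightarrow>
      norm (F z * R z - F x * R x - F' (z - x) * R x) \<le> e * norm (z - x)"
    using d1(1) d2(1) by (intro exI[of _ "min d1 d2"]) auto
qed

text \<open>Only the partial derivatives of \<open>f\<close> are given. The proof moves the arguments from \<open>\<phi> i p\<close> to \<open>\<phi> i x\<close> one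
  index at a time: by the mean value theorem each move contributes \<open>\<phi> k x - \<phi> k p\<close> times a value
  of \<open>g k\<close> at a point that tends to the base point.\<close>
lemma compose_args_chain_rule:
  fixes \<phi> :: "nat \<Rightarrow> real ^ 'n \<Rightarrow> real"
  assumes I: "finite I"
    and f: "\<And>i y. i \<in> I \<Longrightarrow> y \<in> W \<Longrightarrow> ((\<lambda>t. f (y(i := t))) has_real_derivative g i y) (at (y i))"
    and g: "\<And>i \<epsilon>. i \<in> I \<Longrightarrow> \<epsilon> > 0 \<Longrightarrow>
      \<exists>d>0. \<forall>z\<in>arg_box I (\<lambda>i\<in>I. \<phi> i p) d. z \<in> W \<and> \<bar>g i z - g i (\<lambda>i\<in>I. \<phi> i p)\<bar> < \<epsilon>"
    and \<phi>: "\<And>i. i \<in> I \<Longrightarrow> GDERIV (\<phi> i) p :> D i"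
  shows "GDERIV (\<lambda>x. f (\<lambda>i\<in>I. \<phi> i x)) p :> (\<Sum>i\<in>I. g i (\<lambda>i\<in>I. \<phi> i p) *\<^sub>R D i)"
proof -
  let ?y = "\<lambda>i\<in>I. \<phi> i p"
  \<comment> \<open>the intermediate points: the indices in \<open>S\<close> have moved, the others have not\<close>
  define Q where "Q S x = (\<lambda>i\<in>I. if i \<in> S then \<phi> i x else \<phi> i p)" for S x
  have cont: "isCont (\<phi> i) p" if "i \<in> I" for i
    using \<phi>[OF that] unfolding gderiv_def by (rule has_derivative_continuous)
  have "((\<lambda>x. f (Q S x)) has_derivative (\<lambda>h. \<Sum>i\<in>S. (h \<bullet> D i) * g i ?y)) (at p)"
    if "S \<subseteq> I" for S
    using finite_subset[OF that I] that
  proof (induction S rule: finite_induct)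
    case empty
    then show ?case by (simp add: Q_def)
  next
    case (insert k S)
    then have k: "k \<in> I" by simp
    have upd: "Q (insert k S) x = (Q S x)(k := \<phi> k x)" "Q S x = (Q S x)(k := \<phi> k p)" for x
      using k insert.hyps by (auto simp: Q_def)
    define R where "R x = (if \<phi> k x = \<phi> k p then g k ?y
        else (f (Q (insert k S) x) - f (Q S x)) / (\<phi> k x - \<phi> k p))" for x
    have incr: "f (Q (insert k S) x) = f (Q S x) + (\<phi> k x - \<phi> k p) * R x" for x
      using upd[of x] by (auto simp: R_def)
    have "isCont R p"
      unfolding isCont_def
    proof (rule tendstoI)
      fix \<epsilon> :: real assume "\<epsilon> > 0"
      then obtain d where d: "d > 0" "\<And>z. z \<in> arg_box I ?y d \<Longrightarrow> z \<in> W \<and> \<bar>g k z - g k ?y\<bar> < \<epsilon>"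
        using g[OF k] by blast
      have "\<forall>\<^sub>F x in at p. \<forall>i\<in>I. \<bar>\<phi> i x - \<phi> i p\<bar> < d"
        using cont d(1) unfolding isCont_def tendsto_iff dist_real_def
        by (intro eventually_ball_finite[OF I]) blast
      then show "\<forall>\<^sub>F x in at p. dist (R x) (R p) < \<epsilon>"
      proof (rule eventually_mono)
        fix x assume x: "\<forall>i\<in>I. \<bar>\<phi> i x - \<phi> i p\<bar> < d"
        have box: "(Q S x)(k := t) \<in> arg_box I ?y d" if "\<bar>t - \<phi> k p\<bar> < d" for t
          using x d(1) that k by (auto simp: arg_box_def Q_def extensional_def)
        have near: "\<bar>R x - g k ?y\<bar> < \<epsilon>" if ne: "\<phi> k x \<noteq> \<phi> k p"
        proof -
          let ?F = "\<lambda>t. f ((Q S x)(k := t))" and ?G = "\<lambda>t. g k ((Q S x)(k := t))"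
          have der: "(?F has_real_derivative ?G t) (at t)" if "\<bar>t - \<phi> k p\<bar> < d" for t
            using f[OF k, of "(Q S x)(k := t)"] d(2)[OF box[OF that]] by simp
          have "\<exists>t. \<bar>t - \<phi> k p\<bar> < d \<and> R x = ?G t"
          proof (cases "\<phi> k p < \<phi> k x")
            case True
            obtain t where t: "\<phi> k p < t" "t < \<phi> k x"
              "?F (\<phi> k x) - ?F (\<phi> k p) = (\<phi> k x - \<phi> k p) * ?G t"
              using MVT2[OF True, of ?F ?G] der x k by (smt (verit))
            then show ?thesis using x k True upd[of x] by (intro exI[of _ t]) (auto simp: R_def)
          next
            case False
            with ne have lt: "\<phi> k x < \<phi> k p" by simp
            obtain t where t: "\<phi> k x < t" "t < \<phi> k p"
              "?F (\<phi> k p) - ?F (\<phi> k x) = (\<phi> k p - \<phi> k x) * ?G t"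
              using MVT2[OF lt, of ?F ?G] der x k by (smt (verit))
            then have "R x = ?G t"
              using lt upd[of x] by (auto simp: R_def field_simps)
            then show ?thesis using x k t by (intro exI[of _ t]) auto
          qed
          then show ?thesis using d(2)[OF box] by metis
        qed
        show "dist (R x) (R p) < \<epsilon>"
          using near \<open>\<epsilon> > 0\<close> by (cases "\<phi> k x = \<phi> k p") (auto simp: R_def dist_real_def)
      qed
    qed
    moreover have "((\<lambda>x. \<phi> k x - \<phi> k p) has_derivative (\<lambda>h. h \<bullet> D k)) (at p)"
      using \<phi>[OF k] unfolding gderiv_def by (auto intro!: derivative_eq_intros)
    ultimately have "((\<lambda>x. (\<phi> k x - \<phi> k p) * R x) has_derivative (\<lambda>h. (h \<bullet> D k) * R p)) (at p)"
      by (intro has_derivative_mult_vanishing) auto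
    then have "((\<lambda>x. f (Q S x) + (\<phi> k x - \<phi> k p) * R x) has_derivative
        (\<lambda>h. (\<Sum>i\<in>S. (h \<bullet> D i) * g i ?y) + (h \<bullet> D k) * R p)) (at p)"
      using insert by (intro has_derivative_add insert.IH) auto
    moreover have "R p = g k ?y" by (simp add: R_def)
    ultimately show ?case
      unfolding incr by (simp only: sum.insert[OF insert.hyps] add.commute)
  qed
  from this[OF order_refl] show ?thesis
    unfolding gderiv_def by (simp add: Q_def inner_sum_right mult.commute cong: restrict_cong)
qed

lemma solution_compose_args:
  assumes U: "open U" and I: "finite I" and f: "C1_args I W f"
    and W: "\<And>x. x \<in> U \<Longrightarrow> (\<lambda>i\<in>I. \<phi> i x) \<in> W"
    and \<phi>: "\<And>i. i \<in> I \<Longrightarrow> solution U (vf a) (\<lambda>_. 0) (\<phi> i)"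
  shows "solution U (vf a) (\<lambda>_. 0) (\<lambda>x. f (\<lambda>i\<in>I. \<phi> i x))"
proof -
  let ?P = "\<lambda>x. \<lambda>i\<in>I. \<phi> i x"
  obtain g where g: "\<And>i y. i \<in> I \<Longrightarrow> y \<in> W \<Longrightarrow>
      ((\<lambda>t. f (y(i := t))) has_real_derivative g i y) (at (y i))"
    and gc: "\<And>i y \<epsilon>. i \<in> I \<Longrightarrow> y \<in> W \<Longrightarrow> \<epsilon> > 0 \<Longrightarrow>
      \<exists>d>0. \<forall>z\<in>arg_box I y d. z \<in> W \<and> \<bar>g i z - g i y\<bar> < \<epsilon>"
    using f unfolding C1_args_iff[OF I] by metis
  have C1: "C1_on U (\<phi> i)" if "i \<in> I" for i
    using \<phi>[OF that] by (simp add: solution_def)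
  have G: "GDERIV (\<lambda>x. f (?P x)) x :> (\<Sum>i\<in>I. g i (?P x) *\<^sub>R gradv (\<phi> i) x)" if "x \<in> U" for x
    using compose_args_chain_rule[OF I g gc[OF _ W[OF that]] C1_on_GDERIV[OF C1 that]] .
  have "isCont (\<lambda>x. g i (?P x)) x" if i: "i \<in> I" and x: "x \<in> U" for i x
    unfolding isCont_def
  proof (rule tendstoI)
    fix \<epsilon> :: real assume "\<epsilon> > 0"
    then obtain d where d: "d > 0" "\<And>z. z \<in> arg_box I (?P x) d \<Longrightarrow> \<bar>g i z - g i (?P x)\<bar> < \<epsilon>"
      using gc[OF i W[OF x]] by blast
    have "isCont (\<phi> j) x" if "j \<in> I" for j
      using C1_on_continuous[OF C1[OF that]] U x by (simp add: continuous_on_eq_continuous_at)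
    then have "\<forall>\<^sub>F z in at x. \<forall>j\<in>I. \<bar>\<phi> j z - \<phi> j x\<bar> < d"
      using d(1) unfolding isCont_def tendsto_iff dist_real_def
      by (intro eventually_ball_finite[OF I]) blast
    then show "\<forall>\<^sub>F z in at x. dist (g i (?P z)) (g i (?P x)) < \<epsilon>"
      by (rule eventually_mono) (auto intro!: d(2) simp: dist_real_def arg_box_def)
  qed
  then have "continuous_on U (\<lambda>x. \<Sum>i\<in>I. g i (?P x) *\<^sub>R gradv (\<phi> i) x)"
    using C1 by (intro continuous_intros C1_on_continuous_gradv) 
      (auto intro: continuous_at_imp_continuous_on)
  then have "C1_on U (\<lambda>x. f (?P x))"
    using G by (rule C1_onI)
  moreover have "vf a (\<lambda>x. f (?P x)) x = 0" if "x \<in> U" for x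
    using \<phi> that unfolding solution_def vf_eq
    by (simp add: gradv_eq[OF G[OF that]] inner_sum_right)
  ultimately show ?thesis by (simp add: solution_def)
qed

text \<open>The easy half of a general solution: a function of first integrals is a
  first integral by the chain rule.\<close>
theorem form_gives_solutions_add_mult:
  assumes I: "finite I" and \<phi>: "\<And>i. i \<in> I \<Longrightarrow> solution E (vf a) (\<lambda>_. 0) (\<phi> i)"
    and chi0: "solution E (vf_plus a q) b chi0"
    and \<eta>: "solution E (vf_plus a q) (\<lambda>_. 0) \<eta>"
  shows "form_gives_solutions I \<phi> E (solution E (vf_plus a q) b)
    (\<lambda>chi x v. chi x = chi0 x + \<eta> x * v)"
  unfolding form_gives_solutions_def
proof (intro allI impI)
  fix chi assume L: "locally_of_form I \<phi> E (\<lambda>x v. chi x = chi0 x + \<eta> x * v)"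
  show "solution E (vf_plus a q) b chi"
  proof (rule solution_local)
    fix p assume "p \<in> E"
    then obtain U W f where U: "open U" "p \<in> U" "U \<subseteq> E" and f: "C1_args I W f"
      and UW: "\<And>x. x \<in> U \<Longrightarrow> (\<lambda>i\<in>I. \<phi> i x) \<in> W"
        "\<And>x. x \<in> U \<Longrightarrow> chi x = chi0 x + \<eta> x * f (\<lambda>i\<in>I. \<phi> i x)"
      using L unfolding locally_of_form_def of_form_def by metis
    have "solution U (vf_plus a q) b (\<lambda>x. chi0 x + \<eta> x * f (\<lambda>i\<in>I. \<phi> i x))"
      using chi0 \<eta> \<phi> U UW(1) by (intro solution_add_mult solution_compose_args[OF U(1) I f])
        (auto intro: solution_subset)
    then have "solution U (vf_plus a q) b chi"
      using U(1) UW(2) by (rule solution_cong)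
    with U show "\<exists>U. open U \<and> p \<in> U \<and> solution U (vf_plus a q) b chi" by blast
  qed
qed

section \<open>Completing functions to a local chart\<close>

definition jac :: "('n \<Rightarrow> real ^ 'n \<Rightarrow> real) \<Rightarrow> real ^ 'n \<Rightarrow> real ^ 'n ^ 'n" where
  "jac \<Phi> x = (\<chi> j. gradv (\<Phi> j) x)"

lemma jac_mult: "jac \<Phi> x *v h = (\<chi> j. gradv (\<Phi> j) x \<bullet> h)"
  by (simp add: vec_eq_iff jac_def matrix_vector_mul_component)

lemma matrix_inv_mult:
  fixes A :: "real ^ 'n ^ 'n"
  assumes "det A \<noteq> 0"
  shows "A ** matrix_inv A = mat 1" "matrix_inv A ** A = mat 1"
proof -
  have "\<exists>A'. A ** A' = mat 1 \<and> A' ** A = mat 1"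
    using assms by (simp add: invertible_det_nz[symmetric] invertible_def)
  from someI_ex[OF this] show "A ** matrix_inv A = mat 1" "matrix_inv A ** A = mat 1"
    by (simp_all add: matrix_inv_def)
qed

lemma matrix_inv_mult_vector:
  fixes A :: "real ^ 'n ^ 'n"
  assumes "det A \<noteq> 0"
  shows "A *v (matrix_inv A *v h) = h" "matrix_inv A *v (A *v h) = h"
  by (simp_all add: matrix_vector_mul_assoc matrix_inv_mult[OF assms])

lemma continuous_on_det:
  fixes A :: "'a::topological_space \<Rightarrow> real ^ 'n ^ 'n"
  assumes "continuous_on S A" shows "continuous_on S (\<lambda>x. det (A x))"
  unfolding det_def by (intro continuous_intros assms)

text \<open>Cramer's rule exhibits the components as quotients of polynomials in the entries of \<open>A x\<close>.\<close>
lemma continuous_on_matrix_inv_mult: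
  fixes A :: "'a::topological_space \<Rightarrow> real ^ 'n ^ 'n"
  assumes A: "continuous_on S A" and nz: "\<And>x. x \<in> S \<Longrightarrow> det (A x) \<noteq> 0"
  shows "continuous_on S (\<lambda>x. matrix_inv (A x) *v h)"
proof -
  have "continuous_on S
      (\<lambda>x. \<chi> k. det (\<chi> i j. if j = k then h $ i else A x $ i $ j) / det (A x))"
  proof (intro continuous_on_vec_lambda continuous_on_divide continuous_on_det A ballI nz)
    show "continuous_on S (\<lambda>x. if j = k then h $ i else A x $ i $ j)" for i j k
      by (cases "j = k") (auto intro!: continuous_intros A)
  qed
  then show ?thesis
    by (rule continuous_on_eq)
       (simp add: cramer[OF nz, THEN iffD1, OF _ matrix_inv_mult_vector(1)[OF nz]])
qed

lemma continuous_on_jac: "(\<And>j. C1_on E (\<Phi> j)) \<Longrightarrow> continuous_on E (jac \<Phi>)"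
  unfolding jac_def by (intro continuous_on_vec_lambda C1_on_continuous_gradv)

text \<open>The inverse function theorem, with \<open>U\<close> mapped into a coordinate cube on all of which the inverse \<open>G\<close> lives.
  A cube, unlike a general open set, is closed under changing one coordinate towards that of the
  centre.\<close>
lemma local_chart:
  fixes \<Phi> :: "'n \<Rightarrow> real ^ 'n \<Rightarrow> real"
  assumes E: "open E" "p \<in> E" and \<Phi>: "\<And>j. C1_on E (\<Phi> j)" and nz: "det (jac \<Phi> p) \<noteq> 0"
  obtains e U G where "e > 0" "open U" "p \<in> U" "U \<subseteq> E"
    "\<forall>x\<in>U. \<forall>j. \<bar>\<Phi> j x - \<Phi> j p\<bar> < e" "\<forall>x\<in>U. G (\<chi> j. \<Phi> j x) = x"
    "\<forall>z. (\<forall>j. \<bar>z $ j - \<Phi> j p\<bar> < e) \<longrightarrow> G z \<in> E \<and> (\<forall>j. \<Phi> j (G z) = z $ j) \<and>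
      det (jac \<Phi> (G z)) \<noteq> 0 \<and> (G has_derivative (\<lambda>h. matrix_inv (jac \<Phi> (G z)) *v h)) (at z)"
proof -
  define F where "F x = (\<chi> j. \<Phi> j x)" for x
  define F' where "F' x = Blinfun (\<lambda>h. jac \<Phi> x *v h)" for x
  have F': "blinfun_apply (F' x) = (\<lambda>h. jac \<Phi> x *v h)" for x
    unfolding F'_def
    by (intro bounded_linear_Blinfun_apply linear_conv_bounded_linear[THEN iffD1]
        matrix_vector_mul_linear)
  have derF: "(F has_derivative blinfun_apply (F' x)) (at x)" if "x \<in> E" for x
  proof -
    have "((\<lambda>x. F x $ j) has_derivative (\<lambda>h. (jac \<Phi> x *v h) $ j)) (at x)" for j
      using C1_on_GDERIV[OF \<Phi> that, of j] unfolding gderiv_def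
      by (simp add: F_def jac_mult inner_commute)
    then show ?thesis
      unfolding F' by (subst has_derivative_componentwise_within)
        (auto simp: Basis_vec_def inner_axis)
  qed
  have contF': "continuous_on E F'"
    by (rule continuous_on_blinfun_componentwise)
       (auto simp: F' jac_mult intro!: continuous_on_vec_lambda C1_on_continuous_gradv[OF \<Phi>]
          continuous_intros)
  define N where "N = Blinfun (\<lambda>h. matrix_inv (jac \<Phi> p) *v h)"
  have N: "blinfun_apply N = (\<lambda>h. matrix_inv (jac \<Phi> p) *v h)"
    unfolding N_def
    by (intro bounded_linear_Blinfun_apply linear_conv_bounded_linear[THEN iffD1]
        matrix_vector_mul_linear)
  have "N o\<^sub>L F' p = id_blinfun"
    by (rule blinfun_eqI) (simp add: N F' matrix_inv_mult_vector[OF nz])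
  from inverse_function_theorem[OF E(1) derF contF' E(2) this]
  obtain U' V G g' where U': "open U'" "U' \<subseteq> E" "p \<in> U'" and V: "open V" "F p \<in> V"
    and hom: "homeomorphism U' V F G"
    and derG: "\<And>y. y \<in> V \<Longrightarrow> (G has_derivative (g' y)) (at y)"
    and g': "\<And>y. y \<in> V \<Longrightarrow> g' y = inv (blinfun_apply (F' (G y)))"
    and bij: "\<And>y. y \<in> V \<Longrightarrow> bij (blinfun_apply (F' (G y)))"
    by metis
  obtain r where r: "r > 0" "ball (F p) r \<subseteq> V" using V openE by blast
  \<comment> \<open>the norm is at most the sum of the moduli of the coordinates, so this cube lies in the ball\<close>
  define e where "e = r / CARD('n)"
  have e: "e > 0" using r by (simp add: e_def)
  have inV: "z \<in> V" if "\<And>j. \<bar>z $ j - \<Phi> j p\<bar> < e" for z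
  proof -
    have "norm (z - F p) \<le> (\<Sum>j\<in>UNIV. \<bar>(z - F p) $ j\<bar>)" by (rule norm_le_l1_cart)
    also have "\<dots> < (\<Sum>j\<in>(UNIV :: 'n set). e)"
      using that by (intro sum_strict_mono) (auto simp: F_def)
    also have "\<dots> = r" by (simp add: e_def)
    finally show ?thesis using r(2) by (auto simp: dist_norm norm_minus_commute)
  qed
  define U where "U = {x \<in> U'. \<forall>j. \<bar>\<Phi> j x - \<Phi> j p\<bar> < e}"
  have "open U"
  proof -
    have "open {x \<in> U'. \<bar>\<Phi> j x - \<Phi> j p\<bar> < e}" for j
    proof -
      have "continuous_on U' (\<lambda>x. \<bar>\<Phi> j x - \<Phi> j p\<bar>)"
        by (intro continuous_intros continuous_on_subset[OF C1_on_continuous[OF \<Phi>] U'(2)])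
      from continuous_open_preimage[OF this U'(1), of "{..<e}"] show ?thesis
        by (rule back_subst[where P = "open"]) auto
    qed
    then have "open (U' \<inter> (\<Inter>j. {x \<in> U'. \<bar>\<Phi> j x - \<Phi> j p\<bar> < e}))"
      using U'(1) by (intro open_Int open_INT) auto
    also have "\<dots> = U" by (auto simp: U_def)
    finally show ?thesis .
  qed
  show thesis
  proof (rule that[OF e \<open>open U\<close>])
    show "p \<in> U" "U \<subseteq> E" using U' e by (auto simp: U_def)
    show "\<forall>x\<in>U. \<forall>j. \<bar>\<Phi> j x - \<Phi> j p\<bar> < e" by (simp add: U_def)
    show "\<forall>x\<in>U. G (\<chi> j. \<Phi> j x) = x"
      using homeomorphism_apply1[OF hom] by (simp add: U_def F_def)
    have "G z \<in> E \<and> (\<forall>j. \<Phi> j (G z) = z $ j) \<and> det (jac \<Phi> (G z)) \<noteq> 0 \<and>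
        (G has_derivative (\<lambda>h. matrix_inv (jac \<Phi> (G z)) *v h)) (at z)"
      if "\<forall>j. \<bar>z $ j - \<Phi> j p\<bar> < e" for z
    proof -
      have z: "z \<in> V" using that by (intro inV) simp
      have Gz: "G z \<in> E" using hom z U'(2) by (auto simp: homeomorphism_def)
      have "F (G z) = z" using homeomorphism_apply2[OF hom z] .
      then have comp: "\<Phi> j (G z) = z $ j" for j by (auto simp: F_def vec_eq_iff)
      have "inj ((*v) (jac \<Phi> (G z)))" using bij[OF z] by (simp add: F' bij_is_inj)
      then have det: "det (jac \<Phi> (G z)) \<noteq> 0"
        by (simp add: matrix_left_invertible_injective[symmetric] invertible_left_inverse[symmetric]
            invertible_det_nz[symmetric])
      have "inv ((*v) (jac \<Phi> (G z))) = (\<lambda>h. matrix_inv (jac \<Phi> (G z)) *v h)"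
        by (rule inv_unique_comp) (auto simp: fun_eq_iff matrix_inv_mult_vector[OF det])
      then have "(G has_derivative (\<lambda>h. matrix_inv (jac \<Phi> (G z)) *v h)) (at z)"
        using derG[OF z] by (simp add: g'[OF z] F')
      with Gz comp det show ?thesis by blast
    qed
    then show "\<forall>z. (\<forall>j. \<bar>z $ j - \<Phi> j p\<bar> < e) \<longrightarrow> G z \<in> E \<and> (\<forall>j. \<Phi> j (G z) = z $ j) \<and>
        det (jac \<Phi> (G z)) \<noteq> 0 \<and> (G has_derivative (\<lambda>h. matrix_inv (jac \<Phi> (G z)) *v h)) (at z)"
      by blast
  qed
qed

text \<open>A vector orthogonal to the \<open>n - 1\<close> independent rows completes them to an invertible matrix. The map
  \<open>\<tau>\<close> matches the numbering of the given rows with the matrix indices other than \<open>j0\<close>.\<close>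
lemma exists_transversal_row:
  fixes \<tau> :: "'n::finite \<Rightarrow> nat" and d :: "nat \<Rightarrow> real ^ 'n"
  assumes \<tau>: "bij_betw \<tau> (UNIV - {j0}) I"
    and indep: "\<And>c. (\<Sum>i\<in>I. c i *\<^sub>R d i) = 0 \<Longrightarrow> \<forall>i\<in>I. c i = 0"
  obtains v where "det (\<chi> j. if j = j0 then v else d (\<tau> j)) \<noteq> 0"
proof -
  have fin: "finite I" and card: "card I < CARD('n)"
    using bij_betw_finite[OF \<tau>] bij_betw_same_card[OF \<tau>] psubset_card_mono[of UNIV "UNIV - {j0}"]
    by auto
  have "dim (d ` I) \<le> card (d ` I)" using fin by (intro dim_le_card') auto
  also have "\<dots> \<le> card I" using fin by (rule card_image_le)
  finally have "dim (d ` I) < DIM(real ^ 'n)" using card by simp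
  from orthogonal_to_subspace_exists[OF this]
  obtain v where v: "v \<noteq> 0" "\<And>y. y \<in> span (d ` I) \<Longrightarrow> orthogonal v y"
    by blast
  let ?A = "(\<chi> j. if j = j0 then v else d (\<tau> j)) :: real ^ 'n ^ 'n"
  have "\<forall>j. c j = 0" if c: "(\<Sum>j\<in>UNIV. c j *s row j ?A) = 0" for c
  proof -
    have row: "row j ?A = (if j = j0 then v else d (\<tau> j))" for j
      by (simp add: row_def vec_eq_iff)
    have "(\<Sum>j\<in>UNIV - {j0}. c j *\<^sub>R d (\<tau> j)) = (\<Sum>i\<in>I. c (inv_into (UNIV - {j0}) \<tau> i) *\<^sub>R d i)"
      unfolding sum.reindex_bij_betw[OF \<tau>, symmetric]
      using \<tau> by (intro sum.cong) (auto simp: bij_betw_def)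
    moreover have "(\<Sum>j\<in>UNIV. c j *s row j ?A) = c j0 *\<^sub>R v + (\<Sum>j\<in>UNIV - {j0}. c j *\<^sub>R d (\<tau> j))"
      unfolding row scalar_mult_eq_scaleR
      by (subst sum.remove[of UNIV j0]) (auto intro!: sum.cong arg_cong2[where f = "(+)"])
    ultimately have eq: "c j0 *\<^sub>R v + (\<Sum>i\<in>I. c (inv_into (UNIV - {j0}) \<tau> i) *\<^sub>R d i) = 0"
      using c by simp
    have "v \<bullet> d i = 0" if "i \<in> I" for i
      using v(2)[OF span_base, of "d i"] that by (simp add: orthogonal_def)
    then have "v \<bullet> (c j0 *\<^sub>R v + (\<Sum>i\<in>I. c (inv_into (UNIV - {j0}) \<tau> i) *\<^sub>R d i)) = c j0 * (v \<bullet> v)"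
      by (simp add: inner_add_right inner_sum_right)
    then have j0: "c j0 = 0" using eq v(1) by simp
    then have "\<forall>i\<in>I. c (inv_into (UNIV - {j0}) \<tau> i) = 0" using eq by (intro indep) simp
    then have "c j = 0" if "j \<noteq> j0" for j
      using \<tau> that by (auto simp: bij_betw_def)
    with j0 show ?thesis by metis
  qed
  then have "\<exists>B. ?A ** B = mat 1"
    by (simp only: matrix_right_invertible_independent_rows) blast
  then have "det ?A \<noteq> 0"
    by (simp add: invertible_det_nz[symmetric] invertible_right_inverse)
  then show thesis by (rule that)
qed

section \<open>First integrals are functions of independent first integrals\<close>

lemma functionally_independentD:
  assumes "functionally_independent I \<phi> E" "p \<in> E"
    and "\<And>i. i \<in> I \<Longrightarrow> GDERIV (\<phi> i) p :> d i"
    and "(\<Sum>i\<in>I. c i *\<^sub>R d i) = 0"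
  shows "\<forall>i\<in>I. c i = 0"
proof -
  have "(\<Sum>i\<in>I. c i * frechet_derivative (\<phi> i) (at p) h) = h \<bullet> (\<Sum>i\<in>I. c i *\<^sub>R d i)" for h
    unfolding inner_sum_right
    by (intro sum.cong refl) (simp add: frechet_derivative_eq[OF assms(3)])
  with assms show ?thesis
    unfolding functionally_independent_def by simp
qed

text \<open>The vector \<open>w = matrix_inv (jac \<Phi> x) *v axis j0 1\<close> spans the common kernel of the differentials of the
  \<open>\<Phi> j\<close> with \<open>j \<noteq> j0\<close>. Where \<open>a x \<noteq> 0\<close>, the field lies in that kernel and is therefore a nonzero multiple of \<open>w\<close>, so
  \<open>L u = 0\<close> says that \<open>u\<close> has derivative 0 along \<open>w\<close>. Zeros of the field are where nondegeneracy
  enters: the derivative along \<open>w\<close> is continuous, so the set where it is nonzero is open; the field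
  vanishes there, so that set is empty.\<close>
lemma transversal_derivative_zero:
  fixes \<Phi> :: "'n \<Rightarrow> real ^ 'n \<Rightarrow> real"
  assumes E: "open E" and nd: "nondegenerate a E"
    and \<Phi>: "\<And>j. C1_on E (\<Phi> j)"
    and first_integrals: "\<And>j x. j \<noteq> j0 \<Longrightarrow> x \<in> E \<Longrightarrow> vf a (\<Phi> j) x = 0"
    and u: "solution E (vf a) (\<lambda>_. 0) u"
    and x: "x \<in> E" "det (jac \<Phi> x) \<noteq> 0"
  shows "gradv u x \<bullet> (matrix_inv (jac \<Phi> x) *v axis j0 1) = 0"
proof -
  define E' where "E' = {x \<in> E. det (jac \<Phi> x) \<noteq> 0}"
  define r where "r x = gradv u x \<bullet> (matrix_inv (jac \<Phi> x) *v axis j0 1)" for x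
  have jac: "continuous_on E (jac \<Phi>)" by (rule continuous_on_jac[OF \<Phi>])
  have "open E'"
    using continuous_open_preimage[OF continuous_on_det[OF jac] E, of "- {0}"]
    by (rule back_subst[where P = "open"]) (auto simp: E'_def)
  have "continuous_on E' r"
    unfolding r_def
  proof (intro continuous_intros continuous_on_matrix_inv_mult)
    show "continuous_on E' (gradv u)"
      using u by (auto simp: solution_def E'_def
          intro: continuous_on_subset[OF C1_on_continuous_gradv])
    show "continuous_on E' (jac \<Phi>)"
      using jac by (rule continuous_on_subset) (auto simp: E'_def)
  qed (auto simp: E'_def)
  from continuous_open_preimage[OF this \<open>open E'\<close>, of "- {0}"]
  have "open {x \<in> E'. r x \<noteq> 0}"
    by (rule back_subst[where P = "open"]) auto
  moreover have "{x \<in> E'. r x \<noteq> 0} \<subseteq> {x \<in> E. a x = 0}"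
  proof (intro subsetI CollectI conjI)
    fix y assume "y \<in> {x \<in> E'. r x \<noteq> 0}"
    then have y: "y \<in> E" "det (jac \<Phi> y) \<noteq> 0" "r y \<noteq> 0" by (auto simp: E'_def)
    show "y \<in> E" by fact
    define c where "c = gradv (\<Phi> j0) y \<bullet> a y"
    have "jac \<Phi> y *v a y = c *\<^sub>R axis j0 1"
      using first_integrals y(1)
      by (auto simp: jac_mult vec_eq_iff axis_def c_def vf_eq inner_commute)
    then have "matrix_inv (jac \<Phi> y) *v (c *\<^sub>R axis j0 1) = a y"
      using matrix_inv_mult_vector(2)[OF y(2)] by metis
    then have ay: "a y = c *\<^sub>R (matrix_inv (jac \<Phi> y) *v axis j0 1)"
      by (simp add: matrix_vector_mult_scaleR)
    have "gradv u y \<bullet> a y = 0"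
      using u y(1) by (simp add: solution_def vf_eq inner_commute)
    then have "c * r y = 0" by (simp add: ay r_def)
    with y(3) show "a y = 0" by (simp add: ay)
  qed
  ultimately have "{x \<in> E'. r x \<noteq> 0} \<subseteq> interior {x \<in> E. a x = 0}"
    by (intro interior_maximal)
  then have "{x \<in> E'. r x \<noteq> 0} = {}"
    using nd by (simp add: nondegenerate_def)
  with x show ?thesis by (auto simp: E'_def r_def)
qed

text \<open>In the chart whose coordinates are the \<open>\<phi> i\<close> and one linear function, a first integral \<open>u\<close> does not depend
  on the linear coordinate, so freezing that coordinate gives \<open>f\<close>. The last conclusion says that every
  argument in the domain of \<open>f\<close> is attained in \<open>E\<close> and that \<open>f\<close> there is a value of \<open>u\<close>; it makes the
  images open and the local functions \<open>f\<close> comparable when they are glued.\<close>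
lemma local_function_of_first_integrals:
  fixes a :: "real ^ 'n \<Rightarrow> real ^ 'n" and \<phi> :: "nat \<Rightarrow> real ^ 'n \<Rightarrow> real"
  assumes E: "open E" "p \<in> E" and nd: "nondegenerate a E"
    and I: "finite I" "card I = CARD('n) - 1"
    and \<phi>: "\<And>i. i \<in> I \<Longrightarrow> solution E (vf a) (\<lambda>_. 0) (\<phi> i)"
    and indep: "functionally_independent I \<phi> E"
    and u: "solution E (vf a) (\<lambda>_. 0) u"
  obtains W f U where "C1_args I W f" "open U" "p \<in> U" "U \<subseteq> E"
    "\<And>x. x \<in> U \<Longrightarrow> (\<lambda>i\<in>I. \<phi> i x) \<in> W \<and> u x = f (\<lambda>i\<in>I. \<phi> i x)"
    "\<And>y. y \<in> W \<Longrightarrow> \<exists>x\<in>E. (\<lambda>i\<in>I. \<phi> i x) = y \<and> u x = f y"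
proof -
  obtain j0 :: 'n where True by blast
  have "card (UNIV - {j0}) = card I" using I(2) by simp
  then obtain \<tau> where \<tau>: "bij_betw \<tau> (UNIV - {j0}) I"
    using finite_same_card_bij[OF finite I(1)] by metis
  then have \<tau>I: "\<tau> j \<in> I" if "j \<noteq> j0" for j
    using that by (auto simp: bij_betw_def)
  have C1: "C1_on E (\<phi> i)" if "i \<in> I" for i using \<phi>[OF that] by (simp add: solution_def)
  have Cu: "C1_on E u" using u by (simp add: solution_def)
  obtain v where v: "det (\<chi> j. if j = j0 then v else gradv (\<phi> (\<tau> j)) p) \<noteq> 0"
    by (rule exists_transversal_row[OF \<tau>
          functionally_independentD[OF indep E(2) C1_on_GDERIV[OF C1 E(2)]]])
  \<comment> \<open>the chart: a linear coordinate at \<open>j0\<close>, the first integrals at the other indices\<close>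
  define \<Phi> where "\<Phi> j = (if j = j0 then (\<lambda>x. x \<bullet> v) else \<phi> (\<tau> j))" for j
  have lin: "GDERIV (\<lambda>x. x \<bullet> v) x :> v" for x
    unfolding gderiv_def by (auto intro!: derivative_eq_intros)
  have C\<Phi>: "C1_on E (\<Phi> j)" for j
    using lin by (auto simp: \<Phi>_def intro!: C1 \<tau>I C1_onI[where D = "\<lambda>_. v"])
  have "jac \<Phi> p = (\<chi> j. if j = j0 then v else gradv (\<phi> (\<tau> j)) p)"
    by (auto simp: jac_def \<Phi>_def vec_eq_iff gradv_eq[OF lin])
  with v have "det (jac \<Phi> p) \<noteq> 0" by simp
  then obtain e U G where e: "e > 0"
    and U: "open U" "p \<in> U" "U \<subseteq> E"
    and FU: "\<forall>x\<in>U. \<forall>j. \<bar>\<Phi> j x - \<Phi> j p\<bar> < e"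
    and GF: "\<forall>x\<in>U. G (\<chi> j. \<Phi> j x) = x"
    and G: "\<forall>z. (\<forall>j. \<bar>z $ j - \<Phi> j p\<bar> < e) \<longrightarrow> G z \<in> E \<and> (\<forall>j. \<Phi> j (G z) = z $ j) \<and>
      det (jac \<Phi> (G z)) \<noteq> 0 \<and> (G has_derivative (\<lambda>h. matrix_inv (jac \<Phi> (G z)) *v h)) (at z)"
    by (rule local_chart[OF E C\<Phi>]) (rule that)
  define B where "B = {z. \<forall>j. \<bar>z $ j - \<Phi> j p\<bar> < e}"
  have GE: "G z \<in> E" and FG: "\<Phi> j (G z) = z $ j" and detG: "det (jac \<Phi> (G z)) \<noteq> 0"
    and derG: "(G has_derivative (\<lambda>h. matrix_inv (jac \<Phi> (G z)) *v h)) (at z)"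
    if "z \<in> B" for z j
    using G[rule_format, of z] that by (simp_all add: B_def)
  define r where "r j z = gradv u (G z) \<bullet> (matrix_inv (jac \<Phi> (G z)) *v axis j 1)" for j z
  have der_line: "((\<lambda>t. u (G (z + (t - s) *\<^sub>R axis j 1))) has_real_derivative r j z) (at s)"
    if z: "z \<in> B" for z j s
  proof -
    have "(u has_derivative (\<lambda>h. h \<bullet> gradv u (G z))) (at (G z))"
      using C1_on_GDERIV[OF Cu GE[OF z]] by (simp add: gderiv_def)
    from has_derivative_compose[OF derG[OF z] this]
    have uG: "((\<lambda>z. u (G z)) has_derivative
        (\<lambda>h. (matrix_inv (jac \<Phi> (G z)) *v h) \<bullet> gradv u (G z))) (at (z + (s - s) *\<^sub>R axis j 1))"
      by simp
    have "((\<lambda>t. z + (t - s) *\<^sub>R axis j 1) has_derivative (\<lambda>h. h *\<^sub>R axis j 1)) (at s)"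
      by (auto intro!: derivative_eq_intros)
    from has_derivative_compose[OF this uG] show ?thesis
      unfolding has_field_derivative_def
      by (rule back_subst[where P = "\<lambda>D. (_ has_derivative D) _"])
         (auto simp: r_def matrix_vector_mult_scaleR inner_commute)
  qed
  have r0: "r j0 z = 0" if "z \<in> B" for z
    unfolding r_def
  proof (rule transversal_derivative_zero[OF E(1) nd C\<Phi> _ u GE[OF that] detG[OF that]])
    show "vf a (\<Phi> j) x = 0" if "j \<noteq> j0" "x \<in> E" for j x
      using \<phi>[OF \<tau>I[OF that(1)]] that by (simp add: \<Phi>_def solution_def)
  qed
  have contG: "isCont G z" if "z \<in> B" for z
    using derG[OF that] by (rule has_derivative_continuous)
  have "open {x \<in> E. det (jac \<Phi> x) \<noteq> 0}"
    using continuous_open_preimage[OF continuous_on_det[OF continuous_on_jac[OF C\<Phi>]] E(1), of "- {0}"]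
    by (rule back_subst[where P = "open"]) auto
  moreover have "continuous_on {x \<in> E. det (jac \<Phi> x) \<noteq> 0}
      (\<lambda>x. gradv u x \<bullet> (matrix_inv (jac \<Phi> x) *v axis j 1))" for j
    by (intro continuous_intros continuous_on_matrix_inv_mult
        continuous_on_subset[OF C1_on_continuous_gradv[OF Cu]]
        continuous_on_subset[OF continuous_on_jac[OF C\<Phi>]]) auto
  ultimately have "isCont (\<lambda>x. gradv u x \<bullet> (matrix_inv (jac \<Phi> x) *v axis j 1)) (G z)"
    if "z \<in> B" for j z
    using GE[OF that] detG[OF that] by (simp add: continuous_on_eq_continuous_at)
  then have cont_r: "isCont (r j) z" if "z \<in> B" for j z
    unfolding r_def using isCont_o2[OF contG[OF that]] that by blast

  \<comment> \<open>arguments embedded as the slice on which the linear coordinate keeps its value at \<open>p\<close>\<close>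
  define J where "J y = (\<chi> j. if j = j0 then p \<bullet> v else y (\<tau> j))" for y
  define \<sigma> where "\<sigma> = inv_into (UNIV - {j0}) \<tau>"
  have \<sigma>: "\<sigma> i \<noteq> j0" "\<tau> (\<sigma> i) = i" if "i \<in> I" for i
    using that \<tau> inv_into_into[of i \<tau> "UNIV - {j0}"] f_inv_into_f[of i \<tau> "UNIV - {j0}"]
    by (auto simp: \<sigma>_def bij_betw_def)
  have \<sigma>\<tau>: "\<tau> j = i \<longleftrightarrow> j = \<sigma> i" if "i \<in> I" "j \<noteq> j0" for i j
  proof -
    have "\<sigma> (\<tau> j) = j"
      using \<tau> that(2) by (auto simp: \<sigma>_def bij_betw_def)
    then show ?thesis using \<sigma>(2)[OF that(1)] by auto
  qed
  define W where "W = arg_box I (\<lambda>i\<in>I. \<phi> i p) e"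
  define f where "f y = u (G (J y))" for y
  have JB: "J y \<in> B" if "y \<in> W" for y
    using that e \<tau>I by (auto simp: B_def J_def W_def arg_box_def \<Phi>_def)
  have J_upd: "J (y(i := t)) = J y + (t - y i) *\<^sub>R axis (\<sigma> i) 1" if "i \<in> I" for y i t
    using \<sigma>\<tau>[OF that] \<sigma>(1)[OF that]
    by (auto simp: J_def vec_eq_iff axis_def \<sigma>(2)[OF that])
  have J_near: "norm (J z - J y) < CARD('n) * d" if "z \<in> arg_box I y d" "d > 0" for y z and d :: real
  proof -
    have "norm (J z - J y) \<le> (\<Sum>j\<in>UNIV. \<bar>(J z - J y) $ j\<bar>)" by (rule norm_le_l1_cart)
    also have "\<dots> < (\<Sum>j\<in>(UNIV :: 'n set). d)"
      using that \<tau>I by (intro sum_strict_mono) (auto simp: J_def arg_box_def)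
    finally show ?thesis by simp
  qed
  have openW: "openin (arg_space I) W"
    unfolding W_def by (rule openin_arg_box[OF I(1)])
  have "C1_args I W f"
    unfolding C1_args_iff[OF I(1)]
  proof (intro conjI exI[of _ "\<lambda>i y. r (\<sigma> i) (J y)"] ballI allI impI)
    fix i y assume i: "i \<in> I" and y: "y \<in> W"
    show "((\<lambda>t. f (y(i := t))) has_real_derivative r (\<sigma> i) (J y)) (at (y i))"
      unfolding f_def J_upd[OF i] by (rule der_line[OF JB[OF y]])
    fix \<epsilon> :: real assume "\<epsilon> > 0"
    then obtain \<delta> where \<delta>: "\<delta> > 0"
      "\<And>w. dist w (J y) < \<delta> \<Longrightarrow> dist (r (\<sigma> i) w) (r (\<sigma> i) (J y)) < \<epsilon>"
      using cont_r[OF JB[OF y]] unfolding continuous_at_eps_delta by blast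
    obtain d where d: "d > 0" "arg_box I y d \<subseteq> W"
      using openW y unfolding openin_arg_space_iff[OF I(1)] by blast
    let ?d = "min d (\<delta> / CARD('n))"
    have "?d > 0" using d \<delta> by simp
    moreover have "z \<in> W \<and> \<bar>r (\<sigma> i) (J z) - r (\<sigma> i) (J y)\<bar> < \<epsilon>" if z: "z \<in> arg_box I y ?d" for z
    proof
      show "z \<in> W" using z d(2) by (auto simp: arg_box_def)
      have "norm (J z - J y) < CARD('n) * ?d" by (rule J_near[OF z \<open>?d > 0\<close>])
      also have "\<dots> \<le> CARD('n) * (\<delta> / CARD('n))" by (intro mult_left_mono) auto
      also have "\<dots> = \<delta>" by simp
      finally show "\<bar>r (\<sigma> i) (J z) - r (\<sigma> i) (J y)\<bar> < \<epsilon>"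
        using \<delta>(2)[of "J z"] by (simp add: dist_norm)
    qed
    ultimately show "\<exists>d>0. \<forall>z\<in>arg_box I y d. z \<in> W \<and> \<bar>r (\<sigma> i) (J z) - r (\<sigma> i) (J y)\<bar> < \<epsilon>"
      by blast
  qed (rule openW)
  moreover have "(\<lambda>i\<in>I. \<phi> i x) \<in> W \<and> u x = f (\<lambda>i\<in>I. \<phi> i x)" if x: "x \<in> U" for x
  proof
    have "\<bar>\<phi> i x - \<phi> i p\<bar> < e" if "i \<in> I" for i
      using FU[rule_format, OF x, of "\<sigma> i"] \<sigma>[OF that] by (simp add: \<Phi>_def)
    then show W: "(\<lambda>i\<in>I. \<phi> i x) \<in> W" by (auto simp: W_def arg_box_def)
    \<comment> \<open>the segment from the slice to the chart image of \<open>x\<close>, along which \<open>u\<close> is constant\<close>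
    define z where "z t = J (\<lambda>i\<in>I. \<phi> i x) + (t - p \<bullet> v) *\<^sub>R axis j0 1" for t
    have z1: "z (x \<bullet> v) = (\<chi> j. \<Phi> j x)" and z0: "z (p \<bullet> v) = J (\<lambda>i\<in>I. \<phi> i x)"
      using \<tau>I by (auto simp: z_def J_def \<Phi>_def vec_eq_iff axis_def)
    have "\<bar>x \<bullet> v - p \<bullet> v\<bar> < e" using FU[rule_format, OF x, of j0] by (simp add: \<Phi>_def)
    then have zB: "z t \<in> B" if "t \<in> closed_segment (p \<bullet> v) (x \<bullet> v)" for t
      using that JB[OF W] by (auto simp: B_def z_def J_def \<Phi>_def axis_def closed_segment_eq_real_ivl split: if_splits)
    have "((\<lambda>t. u (G (z t))) has_real_derivative 0) (at t within closed_segment (p \<bullet> v) (x \<bullet> v))"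
      if "t \<in> closed_segment (p \<bullet> v) (x \<bullet> v)" for t
    proof -
      have "((\<lambda>s. u (G (z t + (s - t) *\<^sub>R axis j0 1))) has_real_derivative 0) (at t)"
        using der_line[OF zB[OF that], of t j0] r0[OF zB[OF that]] by simp
      moreover have "z t + (s - t) *\<^sub>R axis j0 1 = z s" for s
        by (simp add: z_def algebra_simps)
      ultimately show ?thesis by (simp add: has_field_derivative_at_within)
    qed
    then have "(\<lambda>t. u (G (z t))) constant_on closed_segment (p \<bullet> v) (x \<bullet> v)"
      using has_field_derivative_zero_constant[OF convex_closed_segment] unfolding constant_on_def by metis
    then have "u (G (z (x \<bullet> v))) = u (G (z (p \<bullet> v)))"
      unfolding constant_on_def by (metis ends_in_segment)
    then show "u x = f (\<lambda>i\<in>I. \<phi> i x)"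
      by (simp only: z1 z0 GF[rule_format, OF x] f_def)
  qed
  moreover have "\<exists>x\<in>E. (\<lambda>i\<in>I. \<phi> i x) = y \<and> u x = f y" if y: "y \<in> W" for y
  proof (intro bexI[of _ "G (J y)"] conjI)
    have "\<phi> i (G (J y)) = y i" if "i \<in> I" for i
      using FG[OF JB[OF y], of "\<sigma> i"] \<sigma>[OF that] by (simp add: \<Phi>_def J_def)
    moreover have "y \<in> extensional I" using y by (simp add: W_def arg_box_def)
    ultimately show "(\<lambda>i\<in>I. \<phi> i (G (J y))) = y" by (auto simp: extensional_def)
  qed (use GE[OF JB[OF y]] in \<open>auto simp: f_def\<close>)
  ultimately show thesis using U that by blast
qed

text \<open>A function that is constant on joint level sets factors through the values of the \<open>\<phi> i\<close>. Near each argument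
  the factor agrees with one of the local \<open>f\<close>, so it inherits their differentiability.\<close>
lemma extend_function_of_first_integrals:
  fixes \<phi> :: "nat \<Rightarrow> real ^ 'n \<Rightarrow> real"
  assumes I: "finite I"
    and loc: "\<And>p. p \<in> E \<Longrightarrow> \<exists>W f. C1_args I W f \<and> (\<lambda>i\<in>I. \<phi> i p) \<in> W \<and>
        (\<forall>y\<in>W. \<exists>x\<in>E. (\<lambda>i\<in>I. \<phi> i x) = y \<and> u x = f y)"
    and level: "\<And>x x'. x \<in> E \<Longrightarrow> x' \<in> E \<Longrightarrow> (\<lambda>i\<in>I. \<phi> i x) = (\<lambda>i\<in>I. \<phi> i x') \<Longrightarrow> u x = u x'"
  shows "of_form I \<phi> E (\<lambda>x v. u x = v)"
proof -
  let ?P = "\<lambda>x. \<lambda>i\<in>I. \<phi> i x"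
  define F where "F y = u (SOME x. x \<in> E \<and> ?P x = y)" for y
  have F: "F (?P x) = u x" if "x \<in> E" for x
  proof -
    have "\<exists>x'. x' \<in> E \<and> ?P x' = ?P x" using that by blast
    from someI_ex[OF this] show ?thesis unfolding F_def using level that by blast
  qed
  have loc': "\<exists>W f. C1_args I W f \<and> y \<in> W \<and> W \<subseteq> ?P ` E \<and> (\<forall>z\<in>W. F z = f z)"
    if y: "y \<in> ?P ` E" for y
  proof -
    from y obtain p where p: "p \<in> E" "y = ?P p" by blast
    obtain W f where W: "C1_args I W f" "?P p \<in> W"
      and x: "\<And>z. z \<in> W \<Longrightarrow> \<exists>x\<in>E. ?P x = z \<and> u x = f z"
      using loc[OF p(1)] by blast
    have "W \<subseteq> ?P ` E" using x by blast
    moreover have "F z = f z" if "z \<in> W" for z using x[OF that] F by force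
    ultimately show ?thesis using W p(2) by blast
  qed
  define g where "g i y = deriv (\<lambda>t. F (y(i := t))) (y i)" for i y
  have g: "((\<lambda>t. F (y(i := t))) has_real_derivative g i y) (at (y i)) \<and>
      (\<forall>\<epsilon>>0. \<exists>d>0. \<forall>z\<in>arg_box I y d. z \<in> ?P ` E \<and> \<bar>g i z - g i y\<bar> < \<epsilon>)"
    if i: "i \<in> I" and y: "y \<in> ?P ` E" for i y
  proof -
    obtain W f where W: "C1_args I W f" "y \<in> W" "W \<subseteq> ?P ` E"
      and Ff: "\<And>z. z \<in> W \<Longrightarrow> F z = f z"
      using loc'[OF y] by blast
    then have openW: "openin (arg_space I) W" by (simp add: C1_args_def)
    obtain h where h: "\<And>z. z \<in> W \<Longrightarrow> ((\<lambda>t. f (z(i := t))) has_real_derivative h i z) (at (z i))"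
      and hc: "\<And>\<epsilon>. \<epsilon> > 0 \<Longrightarrow> \<exists>d>0. \<forall>z\<in>arg_box I y d. z \<in> W \<and> \<bar>h i z - h i y\<bar> < \<epsilon>"
      using W(1,2) i unfolding C1_args_iff[OF I] by metis
    have der: "((\<lambda>t. F (z(i := t))) has_real_derivative h i z) (at (z i))" if z: "z \<in> W" for z
    proof -
      obtain e where e: "e > 0" "arg_box I z e \<subseteq> W"
        using openW z unfolding openin_arg_space_iff[OF I] by blast
      have "z \<in> extensional I" using openW z unfolding openin_arg_space_iff[OF I] by blast
      then have "z(i := t) \<in> arg_box I z e" if "t \<in> ball (z i) e" for t
        using that i e(1) by (auto simp: arg_box_def extensional_def dist_real_def)
      then have "f (z(i := t)) = F (z(i := t))" if "t \<in> ball (z i) e" for t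
        using e(2) Ff that by (metis subsetD)
      with h[OF z] e(1) show ?thesis
        by (auto intro: has_field_derivative_transform_within_open[of _ _ _ "ball (z i) e"])
    qed
    then have gh: "g i z = h i z" if "z \<in> W" for z
      unfolding g_def using DERIV_imp_deriv that by blast
    show ?thesis
    proof (intro conjI allI impI)
      show "((\<lambda>t. F (y(i := t))) has_real_derivative g i y) (at (y i))"
        using der[OF W(2)] gh[OF W(2)] by simp
      fix \<epsilon> :: real assume "\<epsilon> > 0"
      then obtain d where "d > 0" "\<And>z. z \<in> arg_box I y d \<Longrightarrow> z \<in> W \<and> \<bar>h i z - h i y\<bar> < \<epsilon>"
        using hc by blast
      then show "\<exists>d>0. \<forall>z\<in>arg_box I y d. z \<in> ?P ` E \<and> \<bar>g i z - g i y\<bar> < \<epsilon>"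
        using W(2,3) gh by (intro exI[of _ d]) auto
    qed
  qed
  have "openin (arg_space I) (?P ` E)"
  proof (subst openin_subopen, intro ballI)
    fix y assume "y \<in> ?P ` E"
    from loc'[OF this] show "\<exists>T. openin (arg_space I) T \<and> y \<in> T \<and> T \<subseteq> ?P ` E"
      unfolding C1_args_def by blast
  qed
  with g have "C1_args I (?P ` E) F"
    unfolding C1_args_iff[OF I] by blast
  with F show ?thesis
    unfolding of_form_def by (intro exI[of _ "?P ` E"] exI[of _ F]) auto
qed

text \<open>On a joint level set, \<open>u\<close> is locally constant by the local representation, so connectedness makes it
  constant there.\<close>
theorem has_form_first_integral:
  fixes a :: "real ^ 'n \<Rightarrow> real ^ 'n" and \<phi> :: "nat \<Rightarrow> real ^ 'n \<Rightarrow> real"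
  assumes E: "open E" and nd: "nondegenerate a E"
    and I: "finite I" "card I = CARD('n) - 1"
    and \<phi>: "\<And>i. i \<in> I \<Longrightarrow> solution E (vf a) (\<lambda>_. 0) (\<phi> i)"
    and indep: "functionally_independent I \<phi> E"
    and u: "solution E (vf a) (\<lambda>_. 0) u"
  shows "has_form I \<phi> E (\<lambda>x v. u x = v)"
proof -
  let ?P = "\<lambda>x. \<lambda>i\<in>I. \<phi> i x"
  have loc: "\<exists>W f U. C1_args I W f \<and> open U \<and> p \<in> U \<and> U \<subseteq> E \<and>
      (\<forall>x\<in>U. ?P x \<in> W \<and> u x = f (?P x)) \<and> (\<forall>y\<in>W. \<exists>x\<in>E. ?P x = y \<and> u x = f y)"
    if "p \<in> E" for p
    by (rule local_function_of_first_integrals[OF E that nd I \<phi> indep u]) blast+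
  have "of_form I \<phi> E (\<lambda>x v. u x = v)" if conn: "connected_levels I \<phi> E"
  proof (rule extend_function_of_first_integrals[OF I(1)])
    show "\<exists>W f. C1_args I W f \<and> ?P p \<in> W \<and> (\<forall>y\<in>W. \<exists>x\<in>E. ?P x = y \<and> u x = f y)"
      if "p \<in> E" for p using loc[OF that] by blast
    fix x x' assume x: "x \<in> E" "x' \<in> E" "?P x = ?P x'"
    define S where "S = {z \<in> E. \<forall>i\<in>I. \<phi> i z = \<phi> i x}"
    have "connected S" unfolding S_def using conn[unfolded connected_levels_def, rule_format, of "\<lambda>i. \<phi> i x"] .
    then have "u constant_on S"
    proof (rule locally_constant_imp_constant)
      fix p assume p: "p \<in> S"
      then have "p \<in> E" by (simp add: S_def)
      from loc[OF this] obtain f U where U: "open U" "p \<in> U"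
        and f: "\<And>z. z \<in> U \<Longrightarrow> u z = f (?P z)" by metis
      have P: "?P z = ?P p" if "z \<in> S" for z
        using that p by (intro restrict_ext) (simp add: S_def)
      have "u z = u p" if "z \<in> S" "z \<in> U" for z
        unfolding f[OF that(2)] f[OF U(2)] P[OF that(1)] ..
      then show "\<exists>T. openin (top_of_set S) T \<and> p \<in> T \<and> (\<forall>z\<in>T. u z = u p)"
        using p U openin_open_Int[OF U(1), of S] by blast
    qed
    moreover have "\<phi> i x' = \<phi> i x" if "i \<in> I" for i
      using fun_cong[OF x(3), of i] that by simp
    then have "x \<in> S" "x' \<in> S" using x(1,2) by (auto simp: S_def)
    ultimately show "u x = u x'" unfolding constant_on_def by metis
  qed
  moreover have "locally_of_form I \<phi> E (\<lambda>x v. u x = v)"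
    unfolding locally_of_form_def
  proof
    fix p assume "p \<in> E"
    from loc[OF this] obtain W f U where "C1_args I W f" "open U" "p \<in> U" "U \<subseteq> E"
      "\<forall>x\<in>U. ?P x \<in> W \<and> u x = f (?P x)"
      by (elim exE conjE)
    then show "\<exists>U. open U \<and> p \<in> U \<and> U \<subseteq> E \<and> of_form I \<phi> U (\<lambda>x v. u x = v)"
      unfolding of_form_def by (intro exI[of _ U] conjI exI[of _ W] exI[of _ f])
  qed
  ultimately show ?thesis by (simp add: has_form_def)
qed

section \<open>General solutions and functional dependence\<close>

lemma of_form_cong:
  "(\<And>x v. x \<in> U \<Longrightarrow> P x v \<longleftrightarrow> Q x v) \<Longrightarrow> of_form I \<phi> U P \<longleftrightarrow> of_form I \<phi> U Q"
  unfolding of_form_def by (intro ex_cong1 conj_cong ball_cong) auto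

lemma locally_of_form_cong:
  assumes "\<And>x v. x \<in> E \<Longrightarrow> P x v \<longleftrightarrow> Q x v"
  shows "locally_of_form I \<phi> E P \<longleftrightarrow> locally_of_form I \<phi> E Q"
proof -
  have "of_form I \<phi> U P \<longleftrightarrow> of_form I \<phi> U Q" if "U \<subseteq> E" for U
    using that assms by (intro of_form_cong) auto
  then show ?thesis unfolding locally_of_form_def by blast
qed

lemma has_form_cong:
  "(\<And>x v. x \<in> E \<Longrightarrow> P x v \<longleftrightarrow> Q x v) \<Longrightarrow> has_form I \<phi> E P \<longleftrightarrow> has_form I \<phi> E Q"
  unfolding has_form_def using locally_of_form_cong[of E P Q] of_form_cong[of E P Q] by metis

theorem general_solution_add_mult:
  fixes a :: "real ^ 'n \<Rightarrow> real ^ 'n" and \<phi> :: "nat \<Rightarrow> real ^ 'n \<Rightarrow> real"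
  assumes E: "open E" and nd: "nondegenerate a E"
    and I: "finite I" "card I = CARD('n) - 1"
    and \<phi>: "\<And>i. i \<in> I \<Longrightarrow> solution E (vf a) (\<lambda>_. 0) (\<phi> i)"
    and indep: "functionally_independent I \<phi> E"
    and chi0: "solution E (vf_plus a q) b chi0"
    and \<eta>: "solution E (vf_plus a q) (\<lambda>_. 0) \<eta>" and nz: "\<And>x. x \<in> E \<Longrightarrow> \<eta> x \<noteq> 0"
  shows "general_solution I \<phi> E (solution E (vf_plus a q) b) (\<lambda>chi x v. chi x = chi0 x + \<eta> x * v)"
  unfolding general_solution_def
proof (intro conjI allI impI form_gives_solutions_add_mult I(1) \<phi> chi0 \<eta>)
  fix chi assume chi: "solution E (vf_plus a q) b chi"
  have "solution E (vf a) (\<lambda>_. 0) (\<lambda>x. (chi x - chi0 x) / \<eta> x)"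
    by (rule solution_divide[OF solution_diff[OF chi chi0] \<eta> nz])
  from has_form_first_integral[OF E nd I \<phi> indep this]
  show "has_form I \<phi> E (\<lambda>x v. chi x = chi0 x + \<eta> x * v)"
    by (rule has_form_cong[THEN iffD1, rotated]) (use nz in \<open>auto simp: field_simps\<close>)
qed

lemma quotient_form_iff:
  assumes "\<And>x. x \<in> E \<Longrightarrow> \<eta> x \<noteq> 0"
  shows "form_gives_solutions I \<phi> E S (\<lambda>chi x v. (chi x - chi0 x) / \<eta> x = v) \<longleftrightarrow>
      form_gives_solutions I \<phi> E S (\<lambda>chi x v. chi x = chi0 x + \<eta> x * v)"
    and "general_solution I \<phi> E S (\<lambda>chi x v. (chi x - chi0 x) / \<eta> x = v) \<longleftrightarrow>
      general_solution I \<phi> E S (\<lambda>chi x v. chi x = chi0 x + \<eta> x * v)"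
proof -
  have *: "(chi x - chi0 x) / \<eta> x = v \<longleftrightarrow> chi x = chi0 x + \<eta> x * v" if "x \<in> E" for chi x v
    using assms[OF that] by (auto simp: field_simps)
  have L: "locally_of_form I \<phi> E (\<lambda>x v. (chi x - chi0 x) / \<eta> x = v) \<longleftrightarrow>
      locally_of_form I \<phi> E (\<lambda>x v. chi x = chi0 x + \<eta> x * v)" for chi
    by (rule locally_of_form_cong) (rule *)
  have H: "has_form I \<phi> E (\<lambda>x v. (chi x - chi0 x) / \<eta> x = v) \<longleftrightarrow>
      has_form I \<phi> E (\<lambda>x v. chi x = chi0 x + \<eta> x * v)" for chi
    by (rule has_form_cong) (rule *)
  show 1: "form_gives_solutions I \<phi> E S (\<lambda>chi x v. (chi x - chi0 x) / \<eta> x = v) \<longleftrightarrow>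
      form_gives_solutions I \<phi> E S (\<lambda>chi x v. chi x = chi0 x + \<eta> x * v)"
    unfolding form_gives_solutions_def L ..
  show "general_solution I \<phi> E S (\<lambda>chi x v. (chi x - chi0 x) / \<eta> x = v) \<longleftrightarrow>
      general_solution I \<phi> E S (\<lambda>chi x v. chi x = chi0 x + \<eta> x * v)"
    unfolding general_solution_def 1 H ..
qed

text \<open>Dependence concerns the indexed family of gradients, so two indices with equal gradients must be
  treated separately from a dependent set of distinct ones.\<close>
lemma more_functions_than_dimensions_dependent:
  fixes X :: "nat \<Rightarrow> real ^ 'n \<Rightarrow> real"
  assumes I: "finite I" "CARD('n) < card I" and X: "\<And>i. i \<in> I \<Longrightarrow> C1_on E (X i)"
  shows "functionally_dependent I X E"
  unfolding functionally_dependent_def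
proof
  fix x assume x: "x \<in> E"
  let ?d = "\<lambda>i. gradv (X i) x"
  have "\<exists>c. (\<exists>i\<in>I. c i \<noteq> 0) \<and> (\<Sum>i\<in>I. c i *\<^sub>R ?d i) = 0"
  proof (cases "inj_on ?d I")
    case True
    then have "dependent (?d ` I)"
      using I by (intro dependent_biggerset) (auto simp: card_image)
    then obtain k where "\<exists>v\<in>?d ` I. k v \<noteq> 0" "(\<Sum>v\<in>?d ` I. k v *\<^sub>R v) = 0"
      using I(1) by (auto simp: dependent_finite)
    then show ?thesis
      by (intro exI[of _ "\<lambda>i. k (?d i)"]) (auto simp: sum.reindex[OF True])
  next
    case False
    then obtain i j where ij: "i \<in> I" "j \<in> I" "i \<noteq> j" "?d i = ?d j" by (auto simp: inj_on_def)
    let ?c = "\<lambda>k. if k = i then 1 else if k = j then -1 else 0 :: real"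
    have "(\<Sum>k\<in>I. ?c k *\<^sub>R ?d k) = (\<Sum>k\<in>{i, j}. ?c k *\<^sub>R ?d k)"
      using ij I(1) by (intro sum.mono_neutral_right) auto
    also have "\<dots> = 0" using ij by simp
    finally show ?thesis using ij(1) by (intro exI[of _ ?c]) auto
  qed
  then obtain c where c: "\<exists>i\<in>I. c i \<noteq> 0" "(\<Sum>i\<in>I. c i *\<^sub>R ?d i) = 0" by blast
  have "(\<Sum>i\<in>I. c i * frechet_derivative (X i) (at x) h) = h \<bullet> (\<Sum>i\<in>I. c i *\<^sub>R ?d i)" for h
    unfolding inner_sum_right
    by (intro sum.cong refl) (simp add: frechet_derivative_eq[OF C1_on_GDERIV[OF X x]])
  with c show "\<exists>c. (\<exists>i\<in>I. c i \<noteq> 0) \<and>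
      (\<forall>h. (\<Sum>i\<in>I. c i * frechet_derivative (X i) (at x) h) = 0)"
    by (intro exI[of _ c]) simp
qed

theorem mainTheorem12:
  fixes E :: "(real ^ 'n) set"
    and a :: "real ^ 'n \<Rightarrow> real ^ 'n"
    and q b chi0 :: "real ^ 'n \<Rightarrow> real"
    and \<phi> :: "nat \<Rightarrow> real ^ 'n \<Rightarrow> real"
    and n :: nat
  assumes n: "n = CARD('n)"
    and E: "open E"
    and a: "continuous_on E a" and q: "continuous_on E q" and b: "continuous_on E b"
    and \<phi>: "\<forall>i\<in>{1..n-1}. solution E (vf a) (\<lambda>_. 0) (\<phi> i)"
    and indep: "functionally_independent {1..n-1} \<phi> E"
    and chi0: "solution E (vf_plus a q) b chi0"
  shows
    "\<comment> \<open>1\<close>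
     ((\<forall>chi. solution E (vf_plus a q) b chi \<longrightarrow>
          solution E (vf_plus a q) (\<lambda>_. 0) (\<lambda>x. chi x - chi0 x)) \<and>
      (\<forall>\<eta>. solution E (vf_plus a q) (\<lambda>_. 0) \<eta> \<and> (\<forall>x\<in>E. \<eta> x \<noteq> 0) \<longrightarrow>
          form_gives_solutions {1..n-1} \<phi> E (solution E (vf_plus a q) b)
            (\<lambda>chi x v. chi x = chi0 x + \<eta> x * v) \<and>
          (nondegenerate a E \<longrightarrow>
            general_solution {1..n-1} \<phi> E (solution E (vf_plus a q) b)
              (\<lambda>chi x v. chi x = chi0 x + \<eta> x * v)))) \<and>
     \<comment> \<open>2 and 3\<close>
     (\<forall>chi1. solution E (vf_plus a q) b chi1 \<and> (\<forall>x\<in>E. chi1 x - chi0 x \<noteq> 0) \<longrightarrow>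
        solution E (vf_plus a q) (\<lambda>_. 0) (\<lambda>x. chi1 x - chi0 x) \<and>
        form_gives_solutions {1..n-1} \<phi> E (solution E (vf_plus a q) b)
          (\<lambda>chi x v. (chi x - chi0 x) / (chi1 x - chi0 x) = v) \<and>
        (nondegenerate a E \<longrightarrow>
          general_solution {1..n-1} \<phi> E (solution E (vf_plus a q) b)
            (\<lambda>chi x v. (chi x - chi0 x) / (chi1 x - chi0 x) = v)) \<and>
        (\<forall>chi2. solution E (vf_plus a q) b chi2 \<longrightarrow>
          solution E (vf a) (\<lambda>_. 0) (\<lambda>x. (chi2 x - chi1 x) / (chi1 x - chi0 x)) \<and>
          (nondegenerate a E \<longrightarrow>
            has_form {1..n-1} \<phi> E (\<lambda>x v. (chi2 x - chi1 x) / (chi1 x - chi0 x) = v)))) \<and>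
     \<comment> \<open>4\<close>
     (\<forall>X :: nat \<Rightarrow> real ^ 'n \<Rightarrow> real.
        (\<forall>k\<in>{0..n}. solution E (vf_plus a q) b (X k)) \<and> (\<forall>x\<in>E. X 1 x - X 0 x \<noteq> 0) \<longrightarrow>
        (let \<rho> = (\<lambda>i x. (X (i + 1) x - X 0 x) / (X 1 x - X 0 x)) in
          (\<forall>k\<in>{1..n}. solution E (vf_plus a q) (\<lambda>_. 0) (\<lambda>x. X k x - X 0 x)) \<and>
          (\<forall>i\<in>{1..n-1}. solution E (vf a) (\<lambda>_. 0) (\<rho> i)) \<and>
          (functionally_independent {1..n-1} \<rho> E \<longrightarrow>
            form_gives_solutions {1..n-1} \<rho> E (solution E (vf_plus a q) b)
              (\<lambda>chi x v. (chi x - X 0 x) / (X 1 x - X 0 x) = v) \<and>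
            (nondegenerate a E \<longrightarrow>
              general_solution {1..n-1} \<rho> E (solution E (vf_plus a q) b)
                (\<lambda>chi x v. (chi x - X 0 x) / (X 1 x - X 0 x) = v) \<and>
              (\<forall>chi'. solution E (vf_plus a q) b chi' \<longrightarrow>
                has_form {1..n-1} \<rho> E (\<lambda>x v. (chi' x - X 0 x) / (X 1 x - X 0 x) = v)))) \<and>
          functionally_dependent {0..n} X E))"
proof (intro conjI allI impI, goal_cases)
  note I = finite_atLeastAtMost[of 1 "n - 1"]
  have card: "card {1..n-1} = CARD('n) - 1" using n by simp
  have n1: "1 \<le> n" unfolding n by (simp add: Suc_leI)
  \<comment> \<open>stated for arbitrary first integrals and an arbitrary base solution: the last part applies it with
    the ratios \<open>\<rho> i\<close> as first integrals\<close>
  have quot: "solution E (vf_plus a q) (\<lambda>_. 0) (\<lambda>x. chi1 x - c0 x) \<and>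
      form_gives_solutions {1..n-1} \<psi> E (solution E (vf_plus a q) b)
        (\<lambda>chi x v. (chi x - c0 x) / (chi1 x - c0 x) = v) \<and>
      (nondegenerate a E \<longrightarrow>
        general_solution {1..n-1} \<psi> E (solution E (vf_plus a q) b)
          (\<lambda>chi x v. (chi x - c0 x) / (chi1 x - c0 x) = v))"
    if c0: "solution E (vf_plus a q) b c0" and chi1: "solution E (vf_plus a q) b chi1"
      and nz: "\<forall>x\<in>E. chi1 x - c0 x \<noteq> 0"
      and \<psi>: "\<And>i. i \<in> {1..n-1} \<Longrightarrow> solution E (vf a) (\<lambda>_. 0) (\<psi> i)"
      and \<psi>_indep: "functionally_independent {1..n-1} \<psi> E"
    for c0 chi1 \<psi>
  proof -
    have \<eta>: "solution E (vf_plus a q) (\<lambda>_. 0) (\<lambda>x. chi1 x - c0 x)"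
      by (rule solution_diff[OF chi1 c0])
    show ?thesis
    proof (intro conjI impI \<eta>)
      show "form_gives_solutions {1..n-1} \<psi> E (solution E (vf_plus a q) b)
          (\<lambda>chi x v. (chi x - c0 x) / (chi1 x - c0 x) = v)"
        by (rule quotient_form_iff(1)[THEN iffD2], erule nz[rule_format])
          (rule form_gives_solutions_add_mult[OF I \<psi> c0 \<eta>])
      show "general_solution {1..n-1} \<psi> E (solution E (vf_plus a q) b)
          (\<lambda>chi x v. (chi x - c0 x) / (chi1 x - c0 x) = v)" if "nondegenerate a E"
        by (rule quotient_form_iff(2)[THEN iffD2], erule nz[rule_format])
          (rule general_solution_add_mult[OF E that I card \<psi> \<psi>_indep c0 \<eta> nz[rule_format]])
    qed
  qed
  {
    case (1 chi)
    then show ?case using chi0 by (rule solution_diff)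
  next
    case (2 \<eta>)
    then show ?case
      using \<phi> chi0 by (intro form_gives_solutions_add_mult I) auto
  next
    case (3 \<eta>)
    then show ?case
      using \<phi> by (intro general_solution_add_mult E I card indep chi0) auto
  next
    case (4 chi1)
    then show ?case using quot[OF chi0 _ _ \<phi>[rule_format] indep] by blast
  next
    case (5 chi1)
    then show ?case using quot[OF chi0 _ _ \<phi>[rule_format] indep] by blast
  next
    case (6 chi1)
    then show ?case using quot[OF chi0 _ _ \<phi>[rule_format] indep] by blast
  next
    case (7 chi1 chi2)
    then show ?case
      using chi0 by (intro solution_divide solution_diff) auto
  next
    case (8 chi1 chi2)
    then have "solution E (vf a) (\<lambda>_. 0) (\<lambda>x. (chi2 x - chi1 x) / (chi1 x - chi0 x))"
      using chi0 by (intro solution_divide solution_diff) auto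
    then show ?case
      using 8 \<phi> by (intro has_form_first_integral E I card indep) auto
  next
    case (9 X)
    define \<rho> where "\<rho> i x = (X (i + 1) x - X 0 x) / (X 1 x - X 0 x)" for i x
    have X: "solution E (vf_plus a q) b (X k)" if "k \<in> {0..n}" for k using 9 that by blast
    have X01: "solution E (vf_plus a q) b (X 0)" "solution E (vf_plus a q) b (X 1)"
      using n1 by (auto intro!: X)
    have nz: "\<forall>x\<in>E. X 1 x - X 0 x \<noteq> 0" using 9 by blast
    have \<rho>: "solution E (vf a) (\<lambda>_. 0) (\<rho> i)" if "i \<in> {1..n-1}" for i
      unfolding \<rho>_def using that nz
      by (intro solution_divide[OF solution_diff[OF X X01(1)] solution_diff[OF X01(2,1)]]) auto
    have "\<forall>k\<in>{1..n}. solution E (vf_plus a q) (\<lambda>_. 0) (\<lambda>x. X k x - X 0 x)"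
      using X X01(1) by (auto intro!: solution_diff)
    moreover have "functionally_dependent {0..n} X E"
      using X n by (intro more_functions_than_dimensions_dependent) (auto simp: solution_def)
    moreover have "form_gives_solutions {1..n-1} \<rho> E (solution E (vf_plus a q) b)
          (\<lambda>chi x v. (chi x - X 0 x) / (X 1 x - X 0 x) = v) \<and>
        (nondegenerate a E \<longrightarrow>
          general_solution {1..n-1} \<rho> E (solution E (vf_plus a q) b)
            (\<lambda>chi x v. (chi x - X 0 x) / (X 1 x - X 0 x) = v) \<and>
          (\<forall>chi'. solution E (vf_plus a q) b chi' \<longrightarrow>
            has_form {1..n-1} \<rho> E (\<lambda>x v. (chi' x - X 0 x) / (X 1 x - X 0 x) = v)))"
      if "functionally_independent {1..n-1} \<rho> E"
      using quot[OF X01 nz \<rho> that] unfolding general_solution_def by blast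
    ultimately show ?case
      unfolding Let_def \<rho>_def[abs_def, symmetric] using \<rho> by blast
  }
qed

end
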